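(* Let $(X,\rho,\mu)$ be a doubling metric measure space. Assume that there are $N$ derivations $D_1,\dots,D_N\in\mathrm{Der}(X,\mu)$ and a function $\lambda\in L^\infty(X,\mu)$ with $\lambda>0$ $\mu$-a.e., such that for every $f\in\mathrm{Lip}^\infty(X)$ there is a set $\Omega_f\subset X$ with $\mu(\Omega_f)=0$ and $$\max_{j=1,\dots,N}|D_jf(x)|\ge\lambda(x)\,\mathrm{Lip}f(x)\qquad\text{for all }x\in X\setminus\Omega_f .$$ Then $X$ admits a measurable differentiable structure whose dimension is at most $N$.
   Context: Doubling metric measure space: a metric space $(X,\rho)$ with a Borel measure $\mu$ for which there is $C$ with $0<\mu(B(x,2r))\le C\mu(B(x,r))<\infty$ for all $x\in X$, $r>0$. $\mathrm{Lip}^\infty(X)$ is the real algebra of bounded Lipschitz functions $X\to\mathbb{R}$ with norm $\|f\|=\max(\sup|f|,\mathbf{L}(f))$, where $\mathbf{L}(f)$ is the global Lipschitz constant. It is a dual Banach space with unique predual (the closed linear span of the point evaluations in $\mathrm{Lip}^\infty(X)^*$), giving its weak* topology; a sequence $f_n$ converges weak* to $f$ iff $\sup_n\|f_n\|<\infty$ and $f_n\to f$ pointwise. A derivation is a bounded linear map $D:\mathrm{Lip}^\infty(X)\to L^\infty(X,\mu)$ with $D(fg)=(Df)g+f(Dg)$, such that $f_n\to f$ weak* in $\mathrm{Lip}^\infty(X)$ implies $Df_n\to Df$ weak* in $L^\infty(X,\mu)$ (dual of $L^1(X,\mu)$); $\mathrm{Der}(X,\mu)$ is the set of derivations. For a Lipschitz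 function $f$, the pointwise upper Lipschitz constant is $$\mathrm{Lip}f(x)=\inf_{r>0}\ \sup_{0<s\le r}\ \frac1s\sup_{y\in B(x,s)}|f(x)-f(y)|.$$ $X$ has a measurable differentiable structure if there are a countable measurable partition (up to a null set) $X=\bigcup_\alpha X_\alpha\cup\Omega$, $\mu(\Omega)=0$, and for each $\alpha$ a non-negative integer $N_\alpha$ and Lipschitz functions $x_\alpha^1,\dots,x_\alpha^{N_\alpha}$ such that for each Lipschitz function $f:X\to\mathbb{R}$ there are unique functions $\frac{\partial f}{\partial x_\alpha^j}\in L^\infty(X_\alpha,\mu)$ with $$\mathrm{Lip}\Big(f-\sum_{j=1}^{N_\alpha}\frac{\partial f}{\partial x_\alpha^j}(x)\,x_\alpha^j\Big)(x)=0\quad\text{for a.e. }x\in X_\alpha$$ (for fixed $x$ the coefficients are constants), and the integers $N_\alpha$ are uniformly bounded. The pairs $(X_\alpha,\{x_\alpha^j\})$ are the charts; the least upper bound of the $N_\alpha$ is the dimension of the structure. *)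

theory Defs
  imports "HOL-Analysis.Analysis"
begin

definition doubling_metric_measure_space :: "'a::metric_space measure \<Rightarrow> bool" where
  "doubling_metric_measure_space M \<longleftrightarrow>
     sets M = sets borel \<and>
     (\<exists>C::real. \<forall>x. \<forall>r>0.
        0 < emeasure M (ball x (2 * r)) \<and>
        emeasure M (ball x (2 * r)) \<le> ennreal C * emeasure M (ball x r) \<and>
        ennreal C * emeasure M (ball x r) < \<infinity>)"

definition is_lipschitz :: "('a::metric_space \<Rightarrow> real) \<Rightarrow> bool" where
  "is_lipschitz f \<longleftrightarrow> (\<exists>L. L-lipschitz_on UNIV f)"

definition lip_const :: "('a::metric_space \<Rightarrow> real) \<Rightarrow> real" where
  "lip_const f = Inf {L. L-lipschitz_on UNIV f}"

definition Lip_inf :: "('a::metric_space \<Rightarrow> real) set" where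
  "Lip_inf = {f. is_lipschitz f \<and> bounded (range f)}"

definition lip_norm :: "('a::metric_space \<Rightarrow> real) \<Rightarrow> real" where
  "lip_norm f = max (SUP x. \<bar>f x\<bar>) (lip_const f)"

text \<open>
  Bounded linear functionals on \<open>Lip_inf\<close>; their values outside \<open>Lip_inf\<close> are irrelevant.
\<close>

definition Lip_inf_dual :: "(('a::metric_space \<Rightarrow> real) \<Rightarrow> real) set" where
  "Lip_inf_dual = {\<phi>.
     (\<forall>f\<in>Lip_inf. \<forall>g\<in>Lip_inf. \<forall>a b. \<phi> (\<lambda>x. a * f x + b * g x) = a * \<phi> f + b * \<phi> g) \<and>
     (\<exists>C. \<forall>f\<in>Lip_inf. \<bar>\<phi> f\<bar> \<le> C * lip_norm f)}"

text \<open>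
  The predual of \<open>Lip_inf\<close>: the closure, in the dual norm, of the linear span of the
  point evaluations.
\<close>

definition Lip_inf_predual :: "(('a::metric_space \<Rightarrow> real) \<Rightarrow> real) set" where
  "Lip_inf_predual = {\<phi> \<in> Lip_inf_dual.
     \<forall>\<epsilon>>0. \<exists>S c. finite S \<and>
       (\<forall>f\<in>Lip_inf. \<bar>\<phi> f - (\<Sum>x\<in>S. c x * f x)\<bar> \<le> \<epsilon> * lip_norm f)}"

definition Lip_inf_weak_star_lim ::
    "(nat \<Rightarrow> 'a::metric_space \<Rightarrow> real) \<Rightarrow> ('a \<Rightarrow> real) \<Rightarrow> bool" where
  "Lip_inf_weak_star_lim F f \<longleftrightarrow>
     (\<forall>n. F n \<in> Lip_inf) \<and> f \<in> Lip_inf \<and>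
     (\<forall>\<phi>\<in>Lip_inf_predual. (\<lambda>n. \<phi> (F n)) \<longlonglongrightarrow> \<phi> f)"

text \<open>
  Elements of \<open>L\<^sup>\<infinity>\<close> are handled through representatives: everything below that concerns
  them is stated, and invariant, up to almost-everywhere equality.
\<close>

definition L_inf :: "'a measure \<Rightarrow> ('a \<Rightarrow> real) set" where
  "L_inf M = {f \<in> borel_measurable M. \<exists>C. AE x in M. \<bar>f x\<bar> \<le> C}"

definition L_inf_weak_star_lim :: "'a measure \<Rightarrow> (nat \<Rightarrow> 'a \<Rightarrow> real) \<Rightarrow> ('a \<Rightarrow> real) \<Rightarrow> bool" where
  "L_inf_weak_star_lim M H h \<longleftrightarrow>
     (\<forall>n. H n \<in> L_inf M) \<and> h \<in> L_inf M \<and>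
     (\<forall>g. integrable M g \<longrightarrow>
        (\<lambda>n. \<integral>x. g x * H n x \<partial>M) \<longlonglongrightarrow> (\<integral>x. g x * h x \<partial>M))"

text \<open>
  A derivation assigns to each \<open>f \<in> Lip_inf\<close> a representative \<open>D f\<close> of an element of
  \<open>L\<^sup>\<infinity>\<close>; the clauses are linearity, boundedness, the Leibniz rule and sequential
  weak* continuity.
\<close>

definition Der :: "'a::metric_space measure \<Rightarrow> (('a \<Rightarrow> real) \<Rightarrow> ('a \<Rightarrow> real)) set" where
  "Der M = {D.
     (\<forall>f\<in>Lip_inf. D f \<in> L_inf M) \<and>
     (\<forall>f\<in>Lip_inf. \<forall>g\<in>Lip_inf. \<forall>a b.
        AE x in M. D (\<lambda>y. a * f y + b * g y) x = a * D f x + b * D g x) \<and>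
     (\<exists>C. \<forall>f\<in>Lip_inf. AE x in M. \<bar>D f x\<bar> \<le> C * lip_norm f) \<and>
     (\<forall>f\<in>Lip_inf. \<forall>g\<in>Lip_inf.
        AE x in M. D (\<lambda>y. f y * g y) x = D f x * g x + f x * D g x) \<and>
     (\<forall>F f. Lip_inf_weak_star_lim F f \<longrightarrow> L_inf_weak_star_lim M (\<lambda>n. D (F n)) (D f))}"

text \<open>
  The pointwise upper Lipschitz constant. It is only used for Lipschitz \<open>f\<close>, for which all
  the suprema and the infimum are over nonempty bounded sets of reals.
\<close>

definition pointwise_Lip :: "('a::metric_space \<Rightarrow> real) \<Rightarrow> 'a \<Rightarrow> real" where
  "pointwise_Lip f x =
     (INF r\<in>{0<..}. SUP s\<in>{0<..r}. (1 / s) * (SUP y\<in>ball x s. \<bar>f x - f y\<bar>))"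

text \<open>
  \<open>g 1, \<dots>, g n\<close> are partial derivatives of \<open>f\<close> with respect to the coordinates
  \<open>\<xi> 1, \<dots>, \<xi> n\<close> on \<open>A\<close>. The coefficients \<open>g j x\<close> are frozen at the point \<open>x\<close> at which
  the pointwise Lipschitz constant is taken.
\<close>

definition partial_derivatives ::
    "'a::metric_space measure \<Rightarrow> 'a set \<Rightarrow> nat \<Rightarrow> (nat \<Rightarrow> 'a \<Rightarrow> real) \<Rightarrow> ('a \<Rightarrow> real) \<Rightarrow>
     (nat \<Rightarrow> 'a \<Rightarrow> real) \<Rightarrow> bool" where
  "partial_derivatives M A n \<xi> f g \<longleftrightarrow>
     (\<forall>j\<in>{1..n}. g j \<in> L_inf (restrict_space M A)) \<and>
     (AE x in restrict_space M A.
        pointwise_Lip (\<lambda>y. f y - (\<Sum>j=1..n. g j x * \<xi> j y)) x = 0)"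

text \<open>
  The charts are \<open>(X \<alpha>, (\<xi> \<alpha> 1, \<dots>, \<xi> \<alpha> (n \<alpha>)))\<close> for \<open>\<alpha> \<in> I\<close>; a set of naturals serves
  as the countable (finite or infinite) index set.
\<close>

definition measurable_differentiable_structure ::
    "'a::metric_space measure \<Rightarrow> nat set \<Rightarrow> (nat \<Rightarrow> 'a set) \<Rightarrow> (nat \<Rightarrow> nat) \<Rightarrow>
     (nat \<Rightarrow> nat \<Rightarrow> 'a \<Rightarrow> real) \<Rightarrow> bool" where
  "measurable_differentiable_structure M I X n \<xi> \<longleftrightarrow>
     (\<forall>\<alpha>\<in>I. X \<alpha> \<in> sets M) \<and>
     disjoint_family_on X I \<and>
     space M - (\<Union>\<alpha>\<in>I. X \<alpha>) \<in> null_sets M \<and>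
     bdd_above (n ` I) \<and>
     (\<forall>\<alpha>\<in>I. \<forall>j\<in>{1..n \<alpha>}. is_lipschitz (\<xi> \<alpha> j)) \<and>
     (\<forall>\<alpha>\<in>I. \<forall>f. is_lipschitz f \<longrightarrow>
        (\<exists>g. partial_derivatives M (X \<alpha>) (n \<alpha>) (\<xi> \<alpha>) f g \<and>
           (\<forall>h. partial_derivatives M (X \<alpha>) (n \<alpha>) (\<xi> \<alpha>) f h \<longrightarrow>
              (\<forall>j\<in>{1..n \<alpha>}. AE x in restrict_space M (X \<alpha>). h j x = g j x))))"

definition structure_dimension :: "nat set \<Rightarrow> (nat \<Rightarrow> nat) \<Rightarrow> nat" where
  "structure_dimension I n = (SUP \<alpha>\<in>I. n \<alpha>)"

end

theory Submission imports Defs begin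

text \<open>
  The charts are built as in Cheeger's theorem, with the pointwise Lipschitz constant at \<open>x\<close> in the
  role of a seminorm on Lipschitz functions. Call \<open>\<xi>\<^sub>1, \<dots>, \<xi>\<^sub>n\<close> independent at \<open>x\<close> with constant
  \<open>\<epsilon>\<close> if every combination \<open>\<Sum>c\<^sub>j \<xi>\<^sub>j\<close> has pointwise Lipschitz constant at least \<open>\<epsilon> * \<Sum>\<bar>c\<^sub>j\<bar>\<close> there.

  The derivations bound the number of independent functions. At almost every \<open>x\<close> the values
  \<open>D\<^sub>i \<xi>\<^sub>j x\<close> form a matrix with \<open>N\<close> rows. If \<open>n > N\<close>, some nonzero \<open>c\<close> is in its kernel, and the hypothesis
  then forces the pointwise Lipschitz constant of \<open>\<Sum>c\<^sub>j \<xi>\<^sub>j\<close> at \<open>x\<close> to vanish. Hence sets on which more than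
  \<open>N\<close> bounded functions are independent with a common constant are null (\<open>null_sets_independent_if_more_than_derivations\<close>).

  The measure is sigma-finite, so for each \<open>n\<close> countably many sets with \<open>n\<close> independent bounded Lipschitz
  functions cover all the others up to null sets (\<open>countable_essential_cover\<close>). Making these sets
  disjoint, with larger \<open>n\<close> taking precedence, partitions almost all of the space into countably many
  pieces, each with an independent tuple of maximal length \<open>n \<le> N\<close>.

  Such a tuple is a coordinate system on its piece (\<open>partial_derivatives_on_maximal_independent_set\<close>).
  If \<open>f\<close> stayed at a positive distance from the span of the tuple at \<open>x\<close>, adding \<open>f\<close> would give
  a longer independent tuple (\<open>independent_at_extend\<close>); by maximality this occurs only on a null set. At the
  other points the nearly optimal coefficient vectors converge, by independence, to the unique
  vector of partial derivatives, and an explicit supremum over rational vectors shows that this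
  limit is a measurable function of \<open>x\<close> (\<open>coefficient\<close>, \<open>pointwise_Lip_coefficient_eq_0\<close>).
\<close>

section \<open>The pointwise Lipschitz constant as a seminorm\<close>

lemma bdd_above_oscillation:
  fixes f :: "'a::metric_space \<Rightarrow> real"
  assumes "L-lipschitz_on UNIV f" "s > 0"
  shows "bdd_above ((\<lambda>y. \<bar>f x - f y\<bar>) ` ball x s)"
proof (rule bdd_aboveI2)
  fix y assume "y \<in> ball x s"
  then have "L * dist x y \<le> L * s"
    using lipschitz_on_nonneg[OF assms(1)] by (intro mult_left_mono) auto
  then show "\<bar>f x - f y\<bar> \<le> L * s"
    using lipschitz_onD[OF assms(1), of x y] by (simp add: dist_real_def)
qed

lemma scaled_oscillation_le_iff:
  assumes "is_lipschitz f" "s > 0"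
  shows "(1 / s) * (SUP y\<in>ball x s. \<bar>f x - f y\<bar>) \<le> a \<longleftrightarrow> (\<forall>y. dist x y < s \<longrightarrow> \<bar>f x - f y\<bar> \<le> a * s)"
proof -
  obtain L where L: "L-lipschitz_on UNIV f"
    using assms(1) by (auto simp: is_lipschitz_def)
  have "(SUP y\<in>ball x s. \<bar>f x - f y\<bar>) \<le> a * s \<longleftrightarrow> (\<forall>y\<in>ball x s. \<bar>f x - f y\<bar> \<le> a * s)"
    using bdd_above_oscillation[OF L assms(2)] assms(2) by (intro cSUP_le_iff) auto
  then show ?thesis
    using assms(2) by (auto simp: field_simps)
qed

lemma scaled_oscillation_nonneg:
  assumes "is_lipschitz f" "s > 0"
  shows "0 \<le> (1 / s) * (SUP y\<in>ball x s. \<bar>f x - f y\<bar>)"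
proof -
  have "\<bar>f x - f x\<bar> \<le> ((1 / s) * (SUP y\<in>ball x s. \<bar>f x - f y\<bar>)) * s"
    using scaled_oscillation_le_iff[OF assms, of x] assms(2) by (metis dist_self order_refl)
  then show ?thesis
    using assms(2) by (simp add: zero_le_mult_iff)
qed

lemma bdd_above_scaled_oscillation:
  assumes "is_lipschitz f"
  shows "bdd_above ((\<lambda>s. (1 / s) * (SUP y\<in>ball x s. \<bar>f x - f y\<bar>)) ` {0<..r})"
proof -
  obtain L where L: "L-lipschitz_on UNIV f"
    using assms by (auto simp: is_lipschitz_def)
  have "\<bar>f x - f y\<bar> \<le> L * s" if "dist x y < s" for y s
    using lipschitz_onD[OF L, of x y] mult_left_mono[of "dist x y" s L] lipschitz_on_nonneg[OF L] that
    by (simp add: dist_real_def)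
  then show ?thesis
    by (intro bdd_aboveI2[of _ _ L]) (use scaled_oscillation_le_iff[OF assms] in auto)
qed

lemma max_slope_le_iff:
  assumes "is_lipschitz f" "r > 0"
  shows "(SUP s\<in>{0<..r}. (1 / s) * (SUP y\<in>ball x s. \<bar>f x - f y\<bar>)) \<le> a \<longleftrightarrow>
    (\<forall>s\<in>{0<..r}. \<forall>y. dist x y < s \<longrightarrow> \<bar>f x - f y\<bar> \<le> a * s)"
proof -
  have "(SUP s\<in>{0<..r}. (1 / s) * (SUP y\<in>ball x s. \<bar>f x - f y\<bar>)) \<le> a \<longleftrightarrow>
    (\<forall>s\<in>{0<..r}. (1 / s) * (SUP y\<in>ball x s. \<bar>f x - f y\<bar>) \<le> a)"
    using bdd_above_scaled_oscillation[OF assms(1)] assms(2) by (intro cSUP_le_iff) auto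
  then show ?thesis
    using scaled_oscillation_le_iff[OF assms(1)] by auto
qed

lemma max_slope_nonneg:
  assumes "is_lipschitz f" "r > 0"
  shows "0 \<le> (SUP s\<in>{0<..r}. (1 / s) * (SUP y\<in>ball x s. \<bar>f x - f y\<bar>))"
  using assms bdd_above_scaled_oscillation[OF assms(1)]
  by (intro cSUP_upper2[of _ _ r] scaled_oscillation_nonneg) auto

lemma pointwise_Lip_nonneg:
  assumes "is_lipschitz f"
  shows "0 \<le> pointwise_Lip f x"
  unfolding pointwise_Lip_def
  using max_slope_nonneg[OF assms] by (intro cINF_greatest) auto

text \<open>
  The two nested suprema and the infimum amount to a single condition on difference quotients:
  for \<open>y \<noteq> x\<close> near \<open>x\<close> one lets the radius \<open>s\<close> decrease to \<open>dist x y\<close>. In this form the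
  seminorm laws, locality and measurability become immediate.
\<close>

lemma pointwise_Lip_le_iff:
  assumes f: "is_lipschitz f" and a: "0 \<le> a"
  shows "pointwise_Lip f x \<le> a \<longleftrightarrow>
    (\<forall>e>a. \<exists>r>0. \<forall>y. dist x y < r \<longrightarrow> \<bar>f x - f y\<bar> \<le> e * dist x y)"
proof (intro iffI allI impI)
  let ?Q = "\<lambda>r. SUP s\<in>{0<..r}. (1 / s) * (SUP y\<in>ball x s. \<bar>f x - f y\<bar>)"
  have bdd: "bdd_below (?Q ` {0<..})"
    using max_slope_nonneg[OF f] by (intro bdd_belowI2[of _ 0]) auto
  {
    fix e assume "pointwise_Lip f x \<le> a" and e: "e > a"
    then have "(INF r\<in>{0<..}. ?Q r) < e"
      by (simp add: pointwise_Lip_def)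
    then obtain r where r: "r > 0" "?Q r < e"
      using bdd by (subst (asm) cINF_less_iff) auto
    have slope: "\<bar>f x - f y\<bar> \<le> e * s" if "s \<in> {0<..r}" "dist x y < s" for s y
      using that r max_slope_le_iff[OF f r(1), of x e] by auto
    have "\<bar>f x - f y\<bar> \<le> e * dist x y" if y: "dist x y < r" for y
    proof (rule ccontr)
      assume "\<not> ?thesis"
      then have "dist x y < \<bar>f x - f y\<bar> / e"
        using e a by (simp add: field_simps)
      then obtain s where s: "dist x y < s" "s < min r (\<bar>f x - f y\<bar> / e)"
        using y dense[of "dist x y" "min r (\<bar>f x - f y\<bar> / e)"] by auto
      then have "0 < s"
        using zero_le_dist[of x y] by linarith
      then have "\<bar>f x - f y\<bar> \<le> e * s"
        using slope[of s y] s by auto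
      moreover have "e * s < \<bar>f x - f y\<bar>"
        using s e a by (simp add: field_simps)
      ultimately show False by simp
    qed
    then show "\<exists>r>0. \<forall>y. dist x y < r \<longrightarrow> \<bar>f x - f y\<bar> \<le> e * dist x y"
      using r(1) by blast
  next
    assume *: "\<forall>e>a. \<exists>r>0. \<forall>y. dist x y < r \<longrightarrow> \<bar>f x - f y\<bar> \<le> e * dist x y"
    show "pointwise_Lip f x \<le> a"
    proof (rule dense_ge)
      fix e assume e: "a < e"
      then obtain r where r: "r > 0" "\<And>y. dist x y < r \<Longrightarrow> \<bar>f x - f y\<bar> \<le> e * dist x y"
        using * by blast
      have "\<bar>f x - f y\<bar> \<le> e * s" if "s \<in> {0<..r}" "dist x y < s" for s y
      proof -
        have "e * dist x y \<le> e * s"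
          using that e a by (intro mult_left_mono) auto
        then show ?thesis
          using r(2)[of y] that by auto
      qed
      then have "?Q r \<le> e"
        using max_slope_le_iff[OF f r(1), of x e] by blast
      then show "pointwise_Lip f x \<le> e"
        unfolding pointwise_Lip_def using r(1) bdd by (intro cINF_lower2[of _ _ r]) auto
    qed
  }
qed

lemma is_lipschitz_add: "is_lipschitz f \<Longrightarrow> is_lipschitz g \<Longrightarrow> is_lipschitz (\<lambda>y. f y + g y)"
  unfolding is_lipschitz_def using lipschitz_on_add by blast

lemma is_lipschitz_diff: "is_lipschitz f \<Longrightarrow> is_lipschitz g \<Longrightarrow> is_lipschitz (\<lambda>y. f y - g y)"
  unfolding is_lipschitz_def using lipschitz_on_diff by blast

lemma is_lipschitz_cmult: "is_lipschitz f \<Longrightarrow> is_lipschitz (\<lambda>y. a * f y)"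
  unfolding is_lipschitz_def using lipschitz_on_cmult_real by blast

lemma is_lipschitz_const: "is_lipschitz (\<lambda>y. a)"
  unfolding is_lipschitz_def using lipschitz_on_constant by blast

lemma is_lipschitz_sum:
  assumes "\<And>j. j \<in> J \<Longrightarrow> is_lipschitz (\<xi> j)"
  shows "is_lipschitz (\<lambda>y. \<Sum>j\<in>J. c j * \<xi> j y)"
  using assms
  by (induction J rule: infinite_finite_induct)
    (auto intro!: is_lipschitz_const is_lipschitz_add is_lipschitz_cmult)

lemma pointwise_Lip_le_lipschitz_bound:
  assumes "L-lipschitz_on UNIV f"
  shows "pointwise_Lip f x \<le> L"
proof (subst pointwise_Lip_le_iff)
  have "\<bar>f x - f y\<bar> \<le> e * dist x y" if "e > L" for e y
    using lipschitz_onD[OF assms, of x y] that mult_right_mono[of L e "dist x y"]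
    by (simp add: dist_real_def)
  then show "\<forall>e>L. \<exists>r>0. \<forall>y. dist x y < r \<longrightarrow> \<bar>f x - f y\<bar> \<le> e * dist x y"
    by (intro allI impI exI[of _ 1]) auto
qed (use assms lipschitz_on_nonneg in \<open>auto simp: is_lipschitz_def\<close>)

lemma pointwise_Lip_add_le:
  assumes f: "is_lipschitz f" and g: "is_lipschitz g"
  shows "pointwise_Lip (\<lambda>y. f y + g y) x \<le> pointwise_Lip f x + pointwise_Lip g x"
proof (subst pointwise_Lip_le_iff)
  show "\<forall>e>pointwise_Lip f x + pointwise_Lip g x. \<exists>r>0. \<forall>y. dist x y < r \<longrightarrow>
    \<bar>f x + g x - (f y + g y)\<bar> \<le> e * dist x y"
  proof (intro allI impI)
    fix e assume e: "pointwise_Lip f x + pointwise_Lip g x < e"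
    define d where "d = (e - (pointwise_Lip f x + pointwise_Lip g x)) / 2"
    have d: "d > 0" "e = (pointwise_Lip f x + d) + (pointwise_Lip g x + d)"
      using e by (simp_all add: d_def field_simps)
    obtain r1 where r1: "r1 > 0"
      "\<And>y. dist x y < r1 \<Longrightarrow> \<bar>f x - f y\<bar> \<le> (pointwise_Lip f x + d) * dist x y"
      using pointwise_Lip_le_iff[OF f pointwise_Lip_nonneg[OF f], of x x] d(1)
      by (metis less_add_same_cancel1 order_refl)
    obtain r2 where r2: "r2 > 0"
      "\<And>y. dist x y < r2 \<Longrightarrow> \<bar>g x - g y\<bar> \<le> (pointwise_Lip g x + d) * dist x y"
      using pointwise_Lip_le_iff[OF g pointwise_Lip_nonneg[OF g], of x x] d(1)
      by (metis less_add_same_cancel1 order_refl)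
    have "\<bar>f x + g x - (f y + g y)\<bar> \<le> e * dist x y" if "dist x y < min r1 r2" for y
    proof -
      have "\<bar>f x + g x - (f y + g y)\<bar> \<le> \<bar>f x - f y\<bar> + \<bar>g x - g y\<bar>" by linarith
      also have "\<dots> \<le> (pointwise_Lip f x + d) * dist x y + (pointwise_Lip g x + d) * dist x y"
        using r1(2)[of y] r2(2)[of y] that by linarith
      finally show ?thesis
        by (subst d(2)) (simp add: algebra_simps)
    qed
    then show "\<exists>r>0. \<forall>y. dist x y < r \<longrightarrow> \<bar>f x + g x - (f y + g y)\<bar> \<le> e * dist x y"
      using r1(1) r2(1) by (intro exI[of _ "min r1 r2"]) auto
  qed
qed (use assms in \<open>auto intro: is_lipschitz_add pointwise_Lip_nonneg add_nonneg_nonneg\<close>)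

lemma pointwise_Lip_cong_near:
  assumes f: "is_lipschitz f" and g: "is_lipschitz g"
    and r: "r > 0" and eq: "\<And>y. dist x y < r \<Longrightarrow> f y = g y"
  shows "pointwise_Lip f x = pointwise_Lip g x"
proof -
  have le: "pointwise_Lip h x \<le> pointwise_Lip k x"
    if h: "is_lipschitz h" and k: "is_lipschitz k"
      and eq: "\<And>y. dist x y < r \<Longrightarrow> h y = k y" for h k
  proof (subst pointwise_Lip_le_iff[OF h pointwise_Lip_nonneg[OF k]], intro allI impI)
    fix e assume "pointwise_Lip k x < e"
    then obtain r' where "r' > 0" "\<And>y. dist x y < r' \<Longrightarrow> \<bar>k x - k y\<bar> \<le> e * dist x y"
      using pointwise_Lip_le_iff[OF k pointwise_Lip_nonneg[OF k], of x x] by auto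
    then show "\<exists>r>0. \<forall>y. dist x y < r \<longrightarrow> \<bar>h x - h y\<bar> \<le> e * dist x y"
      using r eq by (intro exI[of _ "min r r'"]) auto
  qed
  show ?thesis
    using le[OF f g] le[OF g f] eq by force
qed

lemma pointwise_Lip_cmult:
  assumes f: "is_lipschitz f"
  shows "pointwise_Lip (\<lambda>y. a * f y) x = \<bar>a\<bar> * pointwise_Lip f x"
proof -
  have zero: "pointwise_Lip (\<lambda>y. 0 :: real) x = 0"
    using pointwise_Lip_le_lipschitz_bound[OF lipschitz_on_constant, of 0 x]
      pointwise_Lip_nonneg[OF is_lipschitz_const, of 0 x] by simp
  have le: "pointwise_Lip (\<lambda>y. b * h y) x \<le> \<bar>b\<bar> * pointwise_Lip h x"
    if h: "is_lipschitz h" and b: "b \<noteq> 0" for b h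
  proof (subst pointwise_Lip_le_iff)
    show "\<forall>e>\<bar>b\<bar> * pointwise_Lip h x. \<exists>r>0. \<forall>y. dist x y < r \<longrightarrow> \<bar>b * h x - b * h y\<bar> \<le> e * dist x y"
    proof (intro allI impI)
      fix e assume "\<bar>b\<bar> * pointwise_Lip h x < e"
      then have "pointwise_Lip h x < e / \<bar>b\<bar>"
        using b by (simp add: field_simps)
      then obtain r where r: "r > 0" "\<And>y. dist x y < r \<Longrightarrow> \<bar>h x - h y\<bar> \<le> e / \<bar>b\<bar> * dist x y"
        using pointwise_Lip_le_iff[OF h pointwise_Lip_nonneg[OF h], of x x] by auto
      have "\<bar>b * h x - b * h y\<bar> \<le> e * dist x y" if "dist x y < r" for y
      proof -
        have "\<bar>b * h x - b * h y\<bar> = \<bar>b\<bar> * \<bar>h x - h y\<bar>"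
          by (simp add: abs_mult[symmetric] algebra_simps)
        also have "\<dots> \<le> \<bar>b\<bar> * (e / \<bar>b\<bar> * dist x y)"
          using r(2)[OF that] by (intro mult_left_mono) auto
        finally show ?thesis using b by simp
      qed
      then show "\<exists>r>0. \<forall>y. dist x y < r \<longrightarrow> \<bar>b * h x - b * h y\<bar> \<le> e * dist x y"
        using r(1) by blast
    qed
  qed (use h in \<open>auto intro: is_lipschitz_cmult mult_nonneg_nonneg pointwise_Lip_nonneg\<close>)
  show ?thesis
  proof (cases "a = 0")
    case False
    have "pointwise_Lip (\<lambda>y. inverse a * (a * f y)) x \<le> \<bar>inverse a\<bar> * pointwise_Lip (\<lambda>y. a * f y) x"
      using False by (intro le is_lipschitz_cmult f) auto
    then have "\<bar>a\<bar> * pointwise_Lip f x \<le> pointwise_Lip (\<lambda>y. a * f y) x"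
      using False by (simp add: mult.assoc[symmetric] field_simps)
    then show ?thesis
      using le[OF f False] by simp
  qed (simp add: zero)
qed

lemma pointwise_Lip_diff_commute:
  assumes "is_lipschitz f" "is_lipschitz g"
  shows "pointwise_Lip (\<lambda>y. f y - g y) x = pointwise_Lip (\<lambda>y. g y - f y) x"
  using pointwise_Lip_cmult[OF is_lipschitz_diff[OF assms], of "-1" x] by simp

lemma pointwise_Lip_diff_triangle:
  assumes "is_lipschitz f" "is_lipschitz g" "is_lipschitz h"
  shows "pointwise_Lip (\<lambda>y. f y - h y) x \<le>
    pointwise_Lip (\<lambda>y. f y - g y) x + pointwise_Lip (\<lambda>y. g y - h y) x"
  using pointwise_Lip_add_le[OF is_lipschitz_diff[OF assms(1,2)] is_lipschitz_diff[OF assms(2,3)], of x]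
  by simp

lemma pointwise_Lip_sum_le:
  assumes "\<And>j. j \<in> J \<Longrightarrow> is_lipschitz (\<xi> j)"
  shows "pointwise_Lip (\<lambda>y. \<Sum>j\<in>J. c j * \<xi> j y) x \<le> (\<Sum>j\<in>J. \<bar>c j\<bar> * pointwise_Lip (\<xi> j) x)"
  using assms
proof (induction J rule: infinite_finite_induct)
  case (insert j J)
  have "pointwise_Lip (\<lambda>y. c j * \<xi> j y + (\<Sum>j\<in>J. c j * \<xi> j y)) x \<le>
    pointwise_Lip (\<lambda>y. c j * \<xi> j y) x + pointwise_Lip (\<lambda>y. \<Sum>j\<in>J. c j * \<xi> j y) x"
    using insert.prems by (intro pointwise_Lip_add_le is_lipschitz_cmult is_lipschitz_sum) auto
  then show ?case
    using insert by (simp add: pointwise_Lip_cmult)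
qed (use pointwise_Lip_le_lipschitz_bound[OF lipschitz_on_constant] in auto)

text \<open>
  For a fixed slope and a fixed radius the difference quotient condition is closed in \<open>x\<close>,
  because each \<open>y\<close> violating it also does so for all nearby \<open>x\<close>.
\<close>

lemma borel_measurable_pointwise_Lip:
  assumes f: "is_lipschitz (f :: 'a::metric_space \<Rightarrow> real)"
  shows "pointwise_Lip f \<in> borel_measurable borel"
proof (rule borel_measurable_iff_le[THEN iffD2], rule allI)
  obtain L where "L-lipschitz_on UNIV f"
    using f by (auto simp: is_lipschitz_def)
  then have cont: "continuous_on UNIV f"
    by (rule lipschitz_on_continuous_on)
  define S where "S e n = {x. \<forall>y. dist x y < 1 / real (Suc n) \<longrightarrow> \<bar>f x - f y\<bar> \<le> e * dist x y}"
    for e n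
  have closed: "closed (S e n)" for e n
  proof -
    have "S e n = (\<Inter>y. {x. 1 / real (Suc n) \<le> dist x y} \<union> {x. \<bar>f x - f y\<bar> \<le> e * dist x y})"
      by (force simp: S_def not_less)
    moreover have "closed ({x. 1 / real (Suc n) \<le> dist x y} \<union> {x. \<bar>f x - f y\<bar> \<le> e * dist x y})" for y
      by (intro closed_Un closed_Collect_le continuous_intros cont)
    ultimately show ?thesis by auto
  qed
  fix a :: real
  show "{x \<in> space borel. pointwise_Lip f x \<le> a} \<in> sets borel"
  proof (cases "a < 0")
    case True
    then have "{x \<in> space borel. pointwise_Lip f x \<le> a} = {}"
      using pointwise_Lip_nonneg[OF f] by (auto simp: not_le intro: less_le_trans)
    then show ?thesis by simp
  next
    case False
    have "{x \<in> space borel. pointwise_Lip f x \<le> a} = (\<Inter>e\<in>\<rat> \<inter> {a<..}. \<Union>n. S e n)"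
    proof (intro set_eqI iffI)
      fix x assume "x \<in> {x \<in> space borel. pointwise_Lip f x \<le> a}"
      then have *: "\<forall>e>a. \<exists>r>0. \<forall>y. dist x y < r \<longrightarrow> \<bar>f x - f y\<bar> \<le> e * dist x y"
        using pointwise_Lip_le_iff[OF f, of a x] False by simp
      have "\<exists>n. x \<in> S e n" if e: "e > a" for e
      proof -
        obtain r where r: "r > 0" "\<And>y. dist x y < r \<Longrightarrow> \<bar>f x - f y\<bar> \<le> e * dist x y"
          using * e by blast
        obtain n where "1 / real (Suc n) < r"
          using nat_approx_posE[OF r(1)] .
        then have "x \<in> S e n"
          using r(2) by (auto simp: S_def)
        then show ?thesis ..
      qed
      then show "x \<in> (\<Inter>e\<in>\<rat> \<inter> {a<..}. \<Union>n. S e n)" by auto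
    next
      fix x assume x: "x \<in> (\<Inter>e\<in>\<rat> \<inter> {a<..}. \<Union>n. S e n)"
      have "\<exists>r>0. \<forall>y. dist x y < r \<longrightarrow> \<bar>f x - f y\<bar> \<le> e * dist x y" if e: "e > a" for e
      proof -
        obtain q where q: "q \<in> \<rat>" "a < q" "q < e"
          using Rats_dense_in_real[OF e] by blast
        then obtain n where n: "x \<in> S q n"
          using x by blast
        have "\<bar>f x - f y\<bar> \<le> e * dist x y" if "dist x y < 1 / real (Suc n)" for y
        proof -
          have "\<bar>f x - f y\<bar> \<le> q * dist x y"
            using n that unfolding S_def by blast
          also have "\<dots> \<le> e * dist x y"
            using q(3) by (intro mult_right_mono) auto
          finally show ?thesis .
        qed
        then show ?thesis
          by (intro exI[of _ "1 / real (Suc n)"]) auto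
      qed
      then show "x \<in> {x \<in> space borel. pointwise_Lip f x \<le> a}"
        using pointwise_Lip_le_iff[OF f, of a x] False by simp
    qed
    moreover have "(\<Inter>e\<in>\<rat> \<inter> {a<..}. \<Union>n. S e n) \<in> sets borel"
    proof (rule sets.countable_INT'')
      show "countable (\<rat> \<inter> {a<..})"
        using countable_rat by (rule countable_subset[rotated]) auto
      show "(\<Union>n. S e n) \<in> sets borel" for e
        using closed by (intro sets.countable_UN) auto
      show "UNIV \<in> sets (borel :: 'a measure)" by simp
    qed
    ultimately show ?thesis by simp
  qed
qed

section \<open>Linear independence at a point\<close>

text \<open>Rational coefficient vectors, extended by \<open>undefined\<close> outside the index set to make them countably many.\<close>

definition rat_vectors :: "nat \<Rightarrow> (nat \<Rightarrow> real) set" where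
  "rat_vectors n = (\<Pi>\<^sub>E j\<in>{1..n}. \<rat>)"

lemma countable_rat_vectors: "countable (rat_vectors n)"
  unfolding rat_vectors_def by (intro countable_PiE) (auto simp: countable_rat)

lemma rat_vectors_dense:
  obtains r where "\<And>k. r k \<in> rat_vectors n" "\<And>j. j \<in> {1..n} \<Longrightarrow> (\<lambda>k. r k j) \<longlonglongrightarrow> c j"
proof -
  have "\<exists>q. q \<in> \<rat> \<and> c j < q \<and> q < c j + 1 / real (Suc k)" for j k
    using Rats_dense_in_real[of "c j" "c j + 1 / real (Suc k)"] by auto
  then obtain q where q: "\<And>j k. q j k \<in> \<rat> \<and> c j < q j k \<and> q j k < c j + 1 / real (Suc k)"
    by metis
  have "q j \<longlonglongrightarrow> c j" for j
  proof (rule tendsto_sandwich[of "\<lambda>_. c j" _ _ "\<lambda>k. c j + 1 / real (Suc k)"])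
    show "(\<lambda>k. c j + 1 / real (Suc k)) \<longlonglongrightarrow> c j"
      using tendsto_add[OF tendsto_const LIMSEQ_inverse_real_of_nat, of "c j"]
      by (simp add: inverse_eq_divide)
  qed (use q in \<open>auto intro!: always_eventually less_imp_le\<close>)
  then show thesis
    using q by (intro that[of "\<lambda>k. restrict (\<lambda>j. q j k) {1..n}"]) (auto simp: rat_vectors_def)
qed

text \<open>
  The pointwise Lipschitz constant of a combination is continuous in the coefficients, by the
  seminorm laws. Conditions on all coefficient vectors can therefore be tested on the countably
  many rational ones, which is what makes them measurable in \<open>x\<close>.
\<close>

lemma tendsto_pointwise_Lip_diff_sum:
  assumes f: "is_lipschitz f" and \<xi>: "\<And>j. j \<in> {1..n} \<Longrightarrow> is_lipschitz (\<xi> j)"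
    and lim: "\<And>j. j \<in> {1..n} \<Longrightarrow> (\<lambda>k. c k j) \<longlonglongrightarrow> d j"
  shows "(\<lambda>k. pointwise_Lip (\<lambda>y. f y - (\<Sum>j=1..n. c k j * \<xi> j y)) x)
    \<longlonglongrightarrow> pointwise_Lip (\<lambda>y. f y - (\<Sum>j=1..n. d j * \<xi> j y)) x"
proof -
  let ?P = "\<lambda>c. pointwise_Lip (\<lambda>y. f y - (\<Sum>j=1..n. c j * \<xi> j y)) x"
  have le: "?P a - ?P b \<le> (\<Sum>j=1..n. \<bar>b j - a j\<bar> * pointwise_Lip (\<xi> j) x)" for a b
  proof -
    let ?a = "\<lambda>y. f y - (\<Sum>j=1..n. a j * \<xi> j y)" and ?b = "\<lambda>y. f y - (\<Sum>j=1..n. b j * \<xi> j y)"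
    have l: "is_lipschitz ?a" "is_lipschitz ?b"
      by (intro is_lipschitz_diff f is_lipschitz_sum \<xi>; assumption)+
    have "?P a \<le> pointwise_Lip (\<lambda>y. ?a y - ?b y) x + ?P b"
      using pointwise_Lip_add_le[OF is_lipschitz_diff[OF l] l(2), of x] by (simp only: diff_add_cancel)
    also have "(\<lambda>y. ?a y - ?b y) = (\<lambda>y. \<Sum>j=1..n. (b j - a j) * \<xi> j y)"
      by (simp add: sum_subtractf left_diff_distrib)
    finally show ?thesis
      using pointwise_Lip_sum_le[of "{1..n}" \<xi> "\<lambda>j. b j - a j" x] \<xi> by simp
  qed
  have "\<bar>?P (c k) - ?P d\<bar> \<le> (\<Sum>j=1..n. \<bar>c k j - d j\<bar> * pointwise_Lip (\<xi> j) x)" for k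
    using le[of "c k" d] le[of d "c k"] by (simp add: abs_minus_commute)
  then have "\<forall>\<^sub>F k in sequentially. norm (?P (c k) - ?P d) \<le> (\<Sum>j=1..n. \<bar>c k j - d j\<bar> * pointwise_Lip (\<xi> j) x)"
    by (intro always_eventually allI) (simp only: real_norm_def)
  moreover have "(\<lambda>k. \<Sum>j=1..n. \<bar>c k j - d j\<bar> * pointwise_Lip (\<xi> j) x) \<longlonglongrightarrow> (\<Sum>j=1..n. \<bar>d j - d j\<bar> * pointwise_Lip (\<xi> j) x)"
    by (intro tendsto_intros lim)
  then have "(\<lambda>k. \<Sum>j=1..n. \<bar>c k j - d j\<bar> * pointwise_Lip (\<xi> j) x) \<longlonglongrightarrow> 0"
    by simp
  ultimately have "(\<lambda>k. ?P (c k) - ?P d) \<longlonglongrightarrow> 0"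
    by (rule Lim_null_comparison)
  then show ?thesis
    by (rule LIM_zero_cancel)
qed

lemma tendsto_pointwise_Lip_sum:
  assumes \<xi>: "\<And>j. j \<in> {1..n} \<Longrightarrow> is_lipschitz (\<xi> j)"
    and lim: "\<And>j. j \<in> {1..n} \<Longrightarrow> (\<lambda>k. c k j) \<longlonglongrightarrow> d j"
  shows "(\<lambda>k. pointwise_Lip (\<lambda>y. \<Sum>j=1..n. c k j * \<xi> j y) x)
    \<longlonglongrightarrow> pointwise_Lip (\<lambda>y. \<Sum>j=1..n. d j * \<xi> j y) x"
  using tendsto_pointwise_Lip_diff_sum[of "\<lambda>_. 0" n \<xi> "\<lambda>k j. - c k j" "\<lambda>j. - d j" x,
      OF is_lipschitz_const \<xi> tendsto_minus[OF lim]]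
  by (simp add: sum_negf)

definition independent_at :: "nat \<Rightarrow> (nat \<Rightarrow> 'a::metric_space \<Rightarrow> real) \<Rightarrow> real \<Rightarrow> 'a \<Rightarrow> bool" where
  "independent_at n \<xi> \<epsilon> x \<longleftrightarrow>
    (\<forall>c. \<epsilon> * (\<Sum>j=1..n. \<bar>c j\<bar>) \<le> pointwise_Lip (\<lambda>y. \<Sum>j=1..n. c j * \<xi> j y) x)"

lemma independent_at_iff_rat:
  assumes \<xi>: "\<And>j. j \<in> {1..n} \<Longrightarrow> is_lipschitz (\<xi> j)"
  shows "independent_at n \<xi> \<epsilon> x \<longleftrightarrow> (\<forall>c\<in>rat_vectors n.
    \<epsilon> * (\<Sum>j=1..n. \<bar>c j\<bar>) \<le> pointwise_Lip (\<lambda>y. \<Sum>j=1..n. c j * \<xi> j y) x)" (is "_ \<longleftrightarrow> ?rat")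
proof
  assume rat: ?rat
  show "independent_at n \<xi> \<epsilon> x"
    unfolding independent_at_def
  proof
    fix c :: "nat \<Rightarrow> real"
    obtain r where r: "\<And>k. r k \<in> rat_vectors n" "\<And>j. j \<in> {1..n} \<Longrightarrow> (\<lambda>k. r k j) \<longlonglongrightarrow> c j"
      using rat_vectors_dense[of n c] by metis
    show "\<epsilon> * (\<Sum>j=1..n. \<bar>c j\<bar>) \<le> pointwise_Lip (\<lambda>y. \<Sum>j=1..n. c j * \<xi> j y) x"
    proof (rule LIMSEQ_le)
      show "(\<lambda>k. \<epsilon> * (\<Sum>j=1..n. \<bar>r k j\<bar>)) \<longlonglongrightarrow> \<epsilon> * (\<Sum>j=1..n. \<bar>c j\<bar>)"
        using r(2) by (intro tendsto_intros) auto
      show "(\<lambda>k. pointwise_Lip (\<lambda>y. \<Sum>j=1..n. r k j * \<xi> j y) x)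
        \<longlonglongrightarrow> pointwise_Lip (\<lambda>y. \<Sum>j=1..n. c j * \<xi> j y) x"
        using r(2) \<xi> by (intro tendsto_pointwise_Lip_sum) auto
    qed (use rat r(1) in auto)
  qed
qed (auto simp: independent_at_def)

lemma sets_independent_at:
  fixes \<xi> :: "nat \<Rightarrow> 'a::metric_space \<Rightarrow> real"
  assumes \<xi>: "\<And>j. j \<in> {1..n} \<Longrightarrow> is_lipschitz (\<xi> j)"
  shows "{x. independent_at n \<xi> \<epsilon> x} \<in> sets borel"
proof -
  have "{x. independent_at n \<xi> \<epsilon> x} = (\<Inter>c\<in>rat_vectors n.
    {x \<in> space borel. \<epsilon> * (\<Sum>j=1..n. \<bar>c j\<bar>) \<le> pointwise_Lip (\<lambda>y. \<Sum>j=1..n. c j * \<xi> j y) x})"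
    using independent_at_iff_rat[OF \<xi>] by auto
  also have "\<dots> \<in> sets borel"
  proof (rule sets.countable_INT''[OF _ countable_rat_vectors])
    fix c :: "nat \<Rightarrow> real"
    have "pointwise_Lip (\<lambda>y. \<Sum>j=1..n. c j * \<xi> j y) \<in> borel_measurable borel"
      using \<xi> by (intro borel_measurable_pointwise_Lip is_lipschitz_sum) auto
    then show "{x \<in> space borel. \<epsilon> * (\<Sum>j=1..n. \<bar>c j\<bar>)
        \<le> pointwise_Lip (\<lambda>y. \<Sum>j=1..n. c j * \<xi> j y) x} \<in> sets borel"
      by measurable
  qed simp
  finally show ?thesis .
qed

text \<open>
  A function that stays at distance \<open>\<delta>\<close> from the span of an independent tuple extends it to an
  independent tuple. The constant comes from adding \<open>\<delta>\<close> times the bound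
  \<open>\<epsilon> * \<Sum>\<bar>c\<^sub>j\<bar> - L * \<bar>t\<bar>\<close> and \<open>L + \<epsilon>\<close> times the bound \<open>\<delta> * \<bar>t\<bar>\<close>, where \<open>t\<close> is the coefficient of \<open>f\<close>.
\<close>

lemma independent_at_extend:
  assumes f: "L-lipschitz_on UNIV f" and \<xi>: "\<And>j. j \<in> {1..n} \<Longrightarrow> is_lipschitz (\<xi> j)"
    and ind: "independent_at n \<xi> \<epsilon> x" and \<epsilon>: "\<epsilon> > 0" and \<delta>: "\<delta> > 0"
    and far: "\<And>q. \<delta> \<le> pointwise_Lip (\<lambda>y. f y - (\<Sum>j=1..n. q j * \<xi> j y)) x"
  shows "independent_at (Suc n) (\<xi>(Suc n := f)) (\<delta> * \<epsilon> / (\<delta> + L + \<epsilon>)) x"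
  unfolding independent_at_def
proof
  fix c :: "nat \<Rightarrow> real"
  define t where "t = c (Suc n)"
  define s where "s = (\<Sum>j=1..n. \<bar>c j\<bar>)"
  define P where "P = pointwise_Lip (\<lambda>y. t * f y + (\<Sum>j=1..n. c j * \<xi> j y)) x"
  have L: "0 \<le> L"
    using f by (rule lipschitz_on_nonneg)
  have lf: "is_lipschitz f"
    using f by (auto simp: is_lipschitz_def)
  have ls: "is_lipschitz (\<lambda>y. \<Sum>j=1..n. a j * \<xi> j y)" for a
    using \<xi> by (intro is_lipschitz_sum) auto
  have P: "pointwise_Lip (\<lambda>y. \<Sum>j=1..Suc n. c j * (\<xi>(Suc n := f)) j y) x = P"
    by (simp add: P_def t_def add.commute)
  have 1: "\<bar>t\<bar> * \<delta> \<le> P"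
  proof (cases "t = 0")
    case False
    define q where "q = (\<lambda>j. - c j / t)"
    have eq: "t * (f y - (\<Sum>j=1..n. q j * \<xi> j y)) = t * f y + (\<Sum>j=1..n. c j * \<xi> j y)" for y
    proof -
      have "t * (\<Sum>j=1..n. q j * \<xi> j y) = (\<Sum>j=1..n. - (c j * \<xi> j y))"
        unfolding sum_distrib_left q_def using False by (intro sum.cong) auto
      then show ?thesis
        by (simp only: right_diff_distrib sum_negf diff_minus_eq_add)
    qed
    have "P = \<bar>t\<bar> * pointwise_Lip (\<lambda>y. f y - (\<Sum>j=1..n. q j * \<xi> j y)) x"
      unfolding P_def eq[symmetric] by (rule pointwise_Lip_cmult[OF is_lipschitz_diff[OF lf ls]])
    then show ?thesis
      using mult_left_mono[OF far[of q] abs_ge_zero[of t]] by simp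
  qed (use pointwise_Lip_nonneg[OF is_lipschitz_add[OF is_lipschitz_cmult[OF lf] ls], of t c x] in \<open>simp add: P_def\<close>)
  have 2: "\<epsilon> * s \<le> P + \<bar>t\<bar> * L"
  proof -
    have "\<epsilon> * s \<le> pointwise_Lip (\<lambda>y. \<Sum>j=1..n. c j * \<xi> j y) x"
      using ind by (simp add: independent_at_def s_def)
    also have "\<dots> \<le> P + pointwise_Lip (\<lambda>y. (- t) * f y) x"
      using pointwise_Lip_add_le[OF is_lipschitz_add[OF is_lipschitz_cmult[OF lf] ls]
          is_lipschitz_cmult[OF lf], of t c "- t" x] by (simp add: P_def)
    also have "\<dots> \<le> P + \<bar>t\<bar> * L"
      using pointwise_Lip_cmult[OF lf, of "- t" x] pointwise_Lip_le_lipschitz_bound[OF f, of x]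
      by (simp add: mult_left_mono)
    finally show ?thesis .
  qed
  have "\<delta> * \<epsilon> * (s + \<bar>t\<bar>) = \<delta> * (\<epsilon> * s - \<bar>t\<bar> * L) + (L + \<epsilon>) * (\<bar>t\<bar> * \<delta>)"
    by (simp add: algebra_simps)
  also have "\<dots> \<le> \<delta> * P + (L + \<epsilon>) * P"
    using 1 2 L \<epsilon> \<delta> by (intro add_mono mult_left_mono) auto
  finally have "\<delta> * \<epsilon> * (s + \<bar>t\<bar>) \<le> P * (\<delta> + L + \<epsilon>)"
    by (simp add: algebra_simps)
  then have "\<delta> * \<epsilon> / (\<delta> + L + \<epsilon>) * (s + \<bar>t\<bar>) \<le> P"
    using L \<epsilon> \<delta> by (simp add: field_simps)
  then show "\<delta> * \<epsilon> / (\<delta> + L + \<epsilon>) * (\<Sum>j=1..Suc n. \<bar>c j\<bar>)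
    \<le> pointwise_Lip (\<lambda>y. \<Sum>j=1..Suc n. c j * (\<xi>(Suc n := f)) j y) x"
    unfolding P by (simp add: s_def t_def)
qed

section \<open>Coefficients of the differential\<close>

text \<open>
  If \<open>P q = pointwise_Lip (f - \<Sum>q\<^sub>j \<xi>\<^sub>j) x\<close> comes arbitrarily close to \<open>0\<close> and \<open>\<xi>\<close> is
  \<open>\<epsilon>\<close>-independent at \<open>x\<close>, then coefficient vectors with small \<open>P\<close> are close to each other:
  \<open>\<epsilon> * \<bar>q\<^sub>j - q'\<^sub>j\<bar> \<le> P q + P q'\<close>. Hence the \<open>j\<close>-th coefficient of the differential is the
  supremum of \<open>q\<^sub>j - P q / \<epsilon>\<close>. Rational \<open>q\<close> suffice, so that the formula is visibly measurable in \<open>x\<close>.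
  Truncating at \<open>K\<close>, an upper bound for all the \<open>q\<^sub>j - P q / \<epsilon>\<close> at points of independence, makes the
  supremum finite at every other point too.
\<close>

definition coefficient ::
    "nat \<Rightarrow> (nat \<Rightarrow> 'a::metric_space \<Rightarrow> real) \<Rightarrow> real \<Rightarrow> real \<Rightarrow> ('a \<Rightarrow> real) \<Rightarrow> nat \<Rightarrow> 'a \<Rightarrow> real" where
  "coefficient n \<xi> \<epsilon> K f j x =
    (SUP q\<in>rat_vectors n. min K (q j - pointwise_Lip (\<lambda>y. f y - (\<Sum>j=1..n. q j * \<xi> j y)) x / \<epsilon>))"

lemma bdd_above_coefficient:
  "bdd_above ((\<lambda>q. min K (q j - pointwise_Lip (\<lambda>y. f y - (\<Sum>j=1..n. q j * \<xi> j y)) x / \<epsilon>)) ` rat_vectors n)"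
  by (rule bdd_aboveI2[of _ _ K]) simp

lemma rat_vectors_zero: "restrict (\<lambda>_. 0) {1..n} \<in> rat_vectors n"
  by (simp add: rat_vectors_def)

lemma borel_measurable_coefficient:
  fixes \<xi> :: "nat \<Rightarrow> 'a::metric_space \<Rightarrow> real"
  assumes f: "is_lipschitz f" and \<xi>: "\<And>j. j \<in> {1..n} \<Longrightarrow> is_lipschitz (\<xi> j)"
  shows "coefficient n \<xi> \<epsilon> K f j \<in> borel_measurable borel"
proof -
  have [measurable]: "pointwise_Lip (\<lambda>y. f y - (\<Sum>j=1..n. q j * \<xi> j y)) \<in> borel_measurable borel" for q
    using f \<xi> by (intro borel_measurable_pointwise_Lip is_lipschitz_diff is_lipschitz_sum) auto
  show ?thesis
    unfolding coefficient_def[abs_def]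
    by (rule borel_measurable_cSUP[OF countable_rat_vectors _ bdd_above_coefficient]) measurable
qed

lemma abs_coefficient_le:
  assumes f: "L-lipschitz_on UNIV f" and \<epsilon>: "\<epsilon> > 0" and j: "j \<in> {1..n}"
  shows "\<bar>coefficient n \<xi> \<epsilon> (L / \<epsilon>) f j x\<bar> \<le> L / \<epsilon>"
proof -
  have "coefficient n \<xi> \<epsilon> (L / \<epsilon>) f j x \<le> L / \<epsilon>"
    unfolding coefficient_def using rat_vectors_zero[of n] by (intro cSUP_least) auto
  moreover have "- (L / \<epsilon>) \<le> coefficient n \<xi> \<epsilon> (L / \<epsilon>) f j x"
    unfolding coefficient_def
  proof (rule cSUP_upper2[OF bdd_above_coefficient rat_vectors_zero])
    have "pointwise_Lip (\<lambda>y. f y - (\<Sum>j=1..n. (if j \<in> {1..n} then 0 else undefined) * \<xi> j y)) x \<le> L"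
      using pointwise_Lip_le_lipschitz_bound[OF f, of x] by simp
    then show "- (L / \<epsilon>) \<le> min (L / \<epsilon>) (restrict (\<lambda>_. 0) {1..n} j -
      pointwise_Lip (\<lambda>y. f y - (\<Sum>j=1..n. restrict (\<lambda>_. 0) {1..n} j * \<xi> j y)) x / \<epsilon>)"
      using j \<epsilon> lipschitz_on_nonneg[OF f] by (simp add: restrict_def field_simps)
  qed
  ultimately show ?thesis by simp
qed

lemma pointwise_Lip_coefficient_eq_0:
  assumes f: "L-lipschitz_on UNIV f" and \<xi>: "\<And>j. j \<in> {1..n} \<Longrightarrow> is_lipschitz (\<xi> j)"
    and ind: "independent_at n \<xi> \<epsilon> x" and \<epsilon>: "\<epsilon> > 0"
    and near: "\<And>\<delta>. \<delta> > 0 \<Longrightarrow> \<exists>q. pointwise_Lip (\<lambda>y. f y - (\<Sum>j=1..n. q j * \<xi> j y)) x < \<delta>"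
  shows "pointwise_Lip (\<lambda>y. f y - (\<Sum>j=1..n. coefficient n \<xi> \<epsilon> (L / \<epsilon>) f j x * \<xi> j y)) x = 0"
proof -
  define P where "P q = pointwise_Lip (\<lambda>y. f y - (\<Sum>j=1..n. q j * \<xi> j y)) x" for q
  define c where "c j = coefficient n \<xi> \<epsilon> (L / \<epsilon>) f j x" for j
  have lf: "is_lipschitz f"
    using f by (auto simp: is_lipschitz_def)
  have ls: "is_lipschitz (\<lambda>y. \<Sum>j=1..n. a j * \<xi> j y)" for a
    using \<xi> by (intro is_lipschitz_sum) auto
  have P_nonneg: "0 \<le> P q" for q
    unfolding P_def by (intro pointwise_Lip_nonneg is_lipschitz_diff lf ls)
  have cauchy: "\<bar>q j - q' j\<bar> \<le> P q / \<epsilon> + P q' / \<epsilon>" if j: "j \<in> {1..n}" for q q' j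
  proof -
    have "\<epsilon> * \<bar>q j - q' j\<bar> \<le> \<epsilon> * (\<Sum>j=1..n. \<bar>q j - q' j\<bar>)"
      using \<epsilon> j by (intro mult_left_mono member_le_sum) auto
    also have "\<dots> \<le> pointwise_Lip (\<lambda>y. \<Sum>j=1..n. (q j - q' j) * \<xi> j y) x"
      using ind by (simp add: independent_at_def)
    also have "(\<lambda>y. \<Sum>j=1..n. (q j - q' j) * \<xi> j y) =
        (\<lambda>y. (\<Sum>j=1..n. q j * \<xi> j y) - (\<Sum>j=1..n. q' j * \<xi> j y))"
      by (simp add: left_diff_distrib sum_subtractf)
    also have "pointwise_Lip \<dots> x \<le> P q + P q'"
      using pointwise_Lip_diff_triangle[OF ls lf ls, of q q' x] pointwise_Lip_diff_commute[OF ls lf, of q x]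
      by (simp add: P_def)
    finally show ?thesis
      using \<epsilon> by (simp add: field_simps)
  qed
  have upper: "q j - P q / \<epsilon> \<le> L / \<epsilon>" if j: "j \<in> {1..n}" for q j
  proof -
    have "P (\<lambda>_. 0) / \<epsilon> \<le> L / \<epsilon>"
      using pointwise_Lip_le_lipschitz_bound[OF f, of x] \<epsilon> by (intro divide_right_mono) (simp_all add: P_def)
    then show ?thesis
      using cauchy[OF j, of q "\<lambda>_. 0"] by linarith
  qed
  have c_near: "\<bar>c j - q j\<bar> \<le> P q / \<epsilon>" if j: "j \<in> {1..n}" and q: "q \<in> rat_vectors n" for q j
  proof -
    have "c j = (SUP q\<in>rat_vectors n. min (L / \<epsilon>) (q j - P q / \<epsilon>))"
      by (simp add: c_def coefficient_def P_def)
    moreover have "q j - P q / \<epsilon> \<le> (SUP q\<in>rat_vectors n. min (L / \<epsilon>) (q j - P q / \<epsilon>))"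
      using upper[OF j] by (intro cSUP_upper2[OF _ q] bdd_aboveI2[of _ _ "L / \<epsilon>"]) auto
    moreover have "(SUP q\<in>rat_vectors n. min (L / \<epsilon>) (q j - P q / \<epsilon>)) \<le> q j + P q / \<epsilon>"
    proof (rule cSUP_least)
      show "min (L / \<epsilon>) (q' j - P q' / \<epsilon>) \<le> q j + P q / \<epsilon>" for q'
        using cauchy[OF j, of q' q] by linarith
    qed (use q in auto)
    ultimately show ?thesis by linarith
  qed
  have rat_near: "\<exists>q\<in>rat_vectors n. P q < \<delta>" if \<delta>: "\<delta> > 0" for \<delta>
  proof -
    obtain a where a: "P a < \<delta>"
      using near[OF \<delta>] by (auto simp: P_def)
    obtain r where r: "\<And>k. r k \<in> rat_vectors n" "\<And>j. j \<in> {1..n} \<Longrightarrow> (\<lambda>k. r k j) \<longlonglongrightarrow> a j"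
      using rat_vectors_dense[of n a] by metis
    have "(\<lambda>k. P (r k)) \<longlonglongrightarrow> P a"
      unfolding P_def using r(2) \<xi> by (intro tendsto_pointwise_Lip_diff_sum lf) auto
    then have "eventually (\<lambda>k. P (r k) < \<delta>) sequentially"
      using a by (rule order_tendstoD)
    then show ?thesis
      using r(1) eventually_happens'[OF sequentially_bot] by blast
  qed
  have "\<exists>q\<in>rat_vectors n. P q < 1 / real (Suc k)" for k
    by (rule rat_near) simp
  then have "\<exists>q. \<forall>k. q k \<in> rat_vectors n \<and> P (q k) < 1 / real (Suc k)"
    by (intro choice) blast
  then obtain q where q: "\<And>k. q k \<in> rat_vectors n" "\<And>k. P (q k) < 1 / real (Suc k)"
    by blast
  have P_lim: "(\<lambda>k. P (q k)) \<longlonglongrightarrow> 0"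
  proof (rule tendsto_sandwich[of "\<lambda>_. 0" _ _ "\<lambda>k. 1 / real (Suc k)"])
    show "(\<lambda>k. 1 / real (Suc k)) \<longlonglongrightarrow> 0"
      using LIMSEQ_inverse_real_of_nat by (simp add: inverse_eq_divide)
  qed (use q(2)[THEN less_imp_le] P_nonneg in \<open>simp_all only: always_eventually simp_thms tendsto_const\<close>)
  have "(\<lambda>k. q k j) \<longlonglongrightarrow> c j" if j: "j \<in> {1..n}" for j
  proof -
    have "(\<lambda>k. q k j - c j) \<longlonglongrightarrow> 0"
    proof (rule Lim_null_comparison[OF always_eventually])
      show "\<forall>k. norm (q k j - c j) \<le> P (q k) / \<epsilon>"
        using c_near[OF j q(1)] by (simp add: abs_minus_commute)
      show "(\<lambda>k. P (q k) / \<epsilon>) \<longlonglongrightarrow> 0"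
        using tendsto_divide[OF P_lim tendsto_const, of \<epsilon>] \<epsilon> by simp
    qed
    then show ?thesis
      by (rule LIM_zero_cancel)
  qed
  then have "(\<lambda>k. P (q k)) \<longlonglongrightarrow> P c"
    unfolding P_def using \<xi> by (intro tendsto_pointwise_Lip_diff_sum lf) auto
  then have "P c = 0"
    using P_lim LIMSEQ_unique by blast
  then show ?thesis
    by (simp add: P_def c_def)
qed

section \<open>Derivations bound the number of independent functions\<close>

text \<open>More unknowns than equations; Gaussian elimination, one equation at a time.\<close>

lemma homogeneous_system_nontrivial_solution:
  fixes a :: "'i \<Rightarrow> 'j \<Rightarrow> real"
  assumes "finite I" "finite J" "card I < card J"
  shows "\<exists>c. (\<exists>j\<in>J. c j \<noteq> 0) \<and> (\<forall>i\<in>I. (\<Sum>j\<in>J. c j * a i j) = 0)"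
  using assms
proof (induction I arbitrary: J a rule: finite_induct)
  case empty
  then have "J \<noteq> {}" by auto
  then show ?case
    by (intro exI[of _ "\<lambda>_. 1"]) auto
next
  case (insert i I)
  show ?case
  proof (cases "\<forall>j\<in>J. a i j = 0")
    case True
    have "card I < card J"
      using insert by simp
    then obtain c where c: "\<exists>j\<in>J. c j \<noteq> 0" "\<forall>i\<in>I. (\<Sum>j\<in>J. c j * a i j) = 0"
      using insert.IH[OF insert.prems(1), of a] by blast
    moreover have "(\<Sum>j\<in>J. c j * a i j) = 0"
      using True by (intro sum.neutral) auto
    ultimately show ?thesis by auto
  next
    case False
    then obtain p where p: "p \<in> J" "a i p \<noteq> 0" by blast
    have "card I < card (J - {p})"
      using insert p by (simp add: card_Diff_singleton)
    then obtain c where c: "\<exists>j\<in>J - {p}. c j \<noteq> 0"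
        "\<forall>k\<in>I. (\<Sum>j\<in>J - {p}. c j * (a k j - a i j * (a k p / a i p))) = 0"
      using insert.IH[of "J - {p}" "\<lambda>k j. a k j - a i j * (a k p / a i p)"] insert.prems(1) by blast
    define S where "S k = (\<Sum>j\<in>J - {p}. c j * a k j)" for k
    define d where "d = c(p := - S i / a i p)"
    have sum: "(\<Sum>j\<in>J. d j * a k j) = S k - S i / a i p * a k p" for k
    proof -
      have "(\<Sum>j\<in>J. d j * a k j) = d p * a k p + (\<Sum>j\<in>J - {p}. d j * a k j)"
        using insert.prems(1) p(1) by (simp add: sum.remove)
      also have "(\<Sum>j\<in>J - {p}. d j * a k j) = S k"
        unfolding S_def by (intro sum.cong) (auto simp: d_def)
      finally show ?thesis
        by (simp add: d_def)
    qed
    have "S k - S i * (a k p / a i p) = 0" if "k \<in> I" for k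
    proof -
      have "S k - S i * (a k p / a i p) = (\<Sum>j\<in>J - {p}. c j * (a k j - a i j * (a k p / a i p)))"
        unfolding S_def sum_distrib_right sum_subtractf[symmetric]
        by (intro sum.cong) (simp_all only: right_diff_distrib mult.assoc)
      then show ?thesis
        using c(2) that by simp
    qed
    then have "(\<Sum>j\<in>J. d j * a k j) = 0" if "k \<in> insert i I" for k
      using that p(2) by (auto simp: sum)
    moreover have "\<exists>j\<in>J. d j \<noteq> 0"
      using c(1) by (auto simp: d_def)
    ultimately show ?thesis by blast
  qed
qed

lemma Lip_inf_is_lipschitz: "f \<in> Lip_inf \<Longrightarrow> is_lipschitz f"
  by (simp add: Lip_inf_def)

lemma Lip_inf_linear:
  assumes "f \<in> Lip_inf" "g \<in> Lip_inf"
  shows "(\<lambda>y. a * f y + b * g y) \<in> Lip_inf"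
proof -
  have "bounded (range (\<lambda>y. a *\<^sub>R f y + b *\<^sub>R g y))"
    using assms by (intro bounded_plus_comp bounded_scaleR_comp) (auto simp: Lip_inf_def)
  then show ?thesis
    using assms by (auto simp: Lip_inf_def intro: is_lipschitz_add is_lipschitz_cmult)
qed

lemma Lip_inf_zero: "(\<lambda>y. 0) \<in> Lip_inf"
  by (simp add: Lip_inf_def is_lipschitz_const image_constant_conv)

lemma Lip_inf_sum:
  assumes "finite J" "\<And>j. j \<in> J \<Longrightarrow> \<xi> j \<in> Lip_inf"
  shows "(\<lambda>y. \<Sum>j\<in>J. c j * \<xi> j y) \<in> Lip_inf"
  using assms
proof (induction J rule: finite_induct)
  case (insert j J)
  then show ?case
    using Lip_inf_linear[of "\<xi> j" "\<lambda>y. \<Sum>j\<in>J. c j * \<xi> j y" "c j" 1] by simp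
qed (simp add: Lip_inf_zero)

lemma Der_linear:
  assumes "D \<in> Der M" "f \<in> Lip_inf" "g \<in> Lip_inf"
  shows "AE x in M. D (\<lambda>y. a * f y + b * g y) x = a * D f x + b * D g x"
  using assms unfolding Der_def by blast

lemma Der_sum:
  assumes D: "D \<in> Der M" and "finite J" "\<And>j. j \<in> J \<Longrightarrow> \<xi> j \<in> Lip_inf"
  shows "AE x in M. D (\<lambda>y. \<Sum>j\<in>J. c j * \<xi> j y) x = (\<Sum>j\<in>J. c j * D (\<xi> j) x)"
  using assms(2,3)
proof (induction J rule: finite_induct)
  case empty
  show ?case
    using Der_linear[OF D Lip_inf_zero Lip_inf_zero, of 0 0] by simp
next
  case (insert j J)
  have "AE x in M. D (\<lambda>y. c j * \<xi> j y + 1 * (\<Sum>j\<in>J. c j * \<xi> j y)) x =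
    c j * D (\<xi> j) x + 1 * D (\<lambda>y. \<Sum>j\<in>J. c j * \<xi> j y) x"
    using insert by (intro Der_linear[OF D] Lip_inf_sum) auto
  moreover have "AE x in M. D (\<lambda>y. \<Sum>j\<in>J. c j * \<xi> j y) x = (\<Sum>j\<in>J. c j * D (\<xi> j) x)"
    using insert by auto
  ultimately show ?case
    using insert by auto
qed

text \<open>
  At almost every \<open>x\<close> the vectors \<open>(D\<^sub>i \<xi>\<^sub>j x)\<^sub>i\<close>, for \<open>1 \<le> j \<le> n\<close>, are \<open>n > N\<close> vectors in an
  \<open>N\<close>-dimensional space, and a linear relation between them annihilates the upper bound for the
  pointwise Lipschitz constant of the same combination of the \<open>\<xi>\<^sub>j\<close>. Since the coefficients of the
  relation depend on \<open>x\<close>, while the exceptional null set depends on the combination, the bound is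
  used for rational coefficients and passed to the limit.
\<close>

lemma null_sets_independent_if_more_than_derivations:
  fixes M :: "'a::metric_space measure"
  assumes D: "\<And>i. i \<in> {1..N} \<Longrightarrow> D i \<in> Der M"
    and lam: "AE x in M. lam x > 0"
    and bound: "\<And>f. f \<in> Lip_inf \<Longrightarrow> AE x in M.
      lam x * pointwise_Lip f x \<le> (\<Sum>i=1..N. \<bar>D i f x\<bar>)"
    and A: "A \<in> sets M" and n: "N < n" and \<xi>: "\<And>j. j \<in> {1..n} \<Longrightarrow> \<xi> j \<in> Lip_inf"
    and \<epsilon>: "\<epsilon> > 0" and ind: "\<And>x. x \<in> A \<Longrightarrow> independent_at n \<xi> \<epsilon> x"
  shows "A \<in> null_sets M"
proof -
  have "AE x in M. lam x * pointwise_Lip (\<lambda>y. \<Sum>j=1..n. c j * \<xi> j y) x \<le>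
    (\<Sum>i=1..N. \<bar>\<Sum>j=1..n. c j * D i (\<xi> j) x\<bar>)" for c
  proof -
    have "AE x in M. \<forall>i\<in>{1..N}. D i (\<lambda>y. \<Sum>j=1..n. c j * \<xi> j y) x = (\<Sum>j=1..n. c j * D i (\<xi> j) x)"
      using Der_sum[OF D, of _ "{1..n}" \<xi> c] \<xi> by (intro AE_finite_allI) auto
    moreover have "(\<lambda>y. \<Sum>j=1..n. c j * \<xi> j y) \<in> Lip_inf"
      using \<xi> by (intro Lip_inf_sum) auto
    ultimately show ?thesis
      using bound[of "\<lambda>y. \<Sum>j=1..n. c j * \<xi> j y"] by auto
  qed
  then have "AE x in M. \<forall>c\<in>rat_vectors n.
    lam x * pointwise_Lip (\<lambda>y. \<Sum>j=1..n. c j * \<xi> j y) x \<le> (\<Sum>i=1..N. \<bar>\<Sum>j=1..n. c j * D i (\<xi> j) x\<bar>)"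
    by (subst AE_ball_countable[OF countable_rat_vectors]) blast
  with lam have "AE x in M. x \<notin> A"
  proof eventually_elim
    fix x assume lam: "lam x > 0" and bd: "\<forall>c\<in>rat_vectors n.
      lam x * pointwise_Lip (\<lambda>y. \<Sum>j=1..n. c j * \<xi> j y) x \<le> (\<Sum>i=1..N. \<bar>\<Sum>j=1..n. c j * D i (\<xi> j) x\<bar>)"
    show "x \<notin> A"
    proof
      assume "x \<in> A"
      then have x: "independent_at n \<xi> \<epsilon> x" by (rule ind)
      have "card {1..N} < card {1..n}"
        using n by simp
      then obtain c where c: "\<exists>j\<in>{1..n}. c j \<noteq> 0" "\<forall>i\<in>{1..N}. (\<Sum>j=1..n. c j * D i (\<xi> j) x) = 0"
        using homogeneous_system_nontrivial_solution[of "{1..N}" "{1..n}" "\<lambda>i j. D i (\<xi> j) x"] by blast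
      obtain r where r: "\<And>k. r k \<in> rat_vectors n" "\<And>j. j \<in> {1..n} \<Longrightarrow> (\<lambda>k. r k j) \<longlonglongrightarrow> c j"
        using rat_vectors_dense[of n c] by metis
      have "lam x * pointwise_Lip (\<lambda>y. \<Sum>j=1..n. c j * \<xi> j y) x \<le> (\<Sum>i=1..N. \<bar>\<Sum>j=1..n. c j * D i (\<xi> j) x\<bar>)"
      proof (rule LIMSEQ_le)
        show "(\<lambda>k. lam x * pointwise_Lip (\<lambda>y. \<Sum>j=1..n. r k j * \<xi> j y) x)
            \<longlonglongrightarrow> lam x * pointwise_Lip (\<lambda>y. \<Sum>j=1..n. c j * \<xi> j y) x"
          by (intro tendsto_mult tendsto_const tendsto_pointwise_Lip_sum r(2) Lip_inf_is_lipschitz \<xi>)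
        show "(\<lambda>k. \<Sum>i=1..N. \<bar>\<Sum>j=1..n. r k j * D i (\<xi> j) x\<bar>)
            \<longlonglongrightarrow> (\<Sum>i=1..N. \<bar>\<Sum>j=1..n. c j * D i (\<xi> j) x\<bar>)"
          by (intro tendsto_sum tendsto_rabs tendsto_mult tendsto_const r(2))
        show "\<exists>K. \<forall>k\<ge>K. lam x * pointwise_Lip (\<lambda>y. \<Sum>j=1..n. r k j * \<xi> j y) x \<le>
            (\<Sum>i=1..N. \<bar>\<Sum>j=1..n. r k j * D i (\<xi> j) x\<bar>)"
          using bd r(1) by blast
      qed
      also have "\<dots> = 0"
        using c(2) by simp
      finally have "pointwise_Lip (\<lambda>y. \<Sum>j=1..n. c j * \<xi> j y) x \<le> 0"
        using lam by (simp add: mult_le_0_iff)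
      then have "\<epsilon> * (\<Sum>j=1..n. \<bar>c j\<bar>) \<le> 0"
        using x[unfolded independent_at_def, rule_format, of c] by linarith
      moreover have "0 < (\<Sum>j=1..n. \<bar>c j\<bar>)"
      proof -
        obtain p where p: "p \<in> {1..n}" "c p \<noteq> 0"
          using c(1) by blast
        show ?thesis
          by (rule sum_pos2[OF _ p(1)]) (use p(2) in auto)
      qed
      ultimately show False
        using \<epsilon> by (simp add: mult_le_0_iff)
    qed
  qed
  then show ?thesis
    using AE_iff_null_sets[OF A] by blast
qed

section \<open>Exhaustion up to null sets\<close>

text \<open>
  For a finite measure, a countable subfamily whose union has the largest possible measure absorbs
  every member of the family. A sigma-finite measure has the same null sets as a finite one.
\<close>

lemma (in sigma_finite_measure) countable_essential_cover:
  assumes "\<G> \<subseteq> sets M" "\<G> \<noteq> {}"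
  obtains G :: "nat \<Rightarrow> 'a set" where "range G \<subseteq> \<G>" "\<And>A. A \<in> \<G> \<Longrightarrow> A - (\<Union>k. G k) \<in> null_sets M"
proof -
  obtain h where h: "h \<in> borel_measurable M" "integral\<^sup>N M h \<noteq> \<infinity>" "\<And>x. x \<in> space M \<Longrightarrow> 0 < h x"
    using Ex_finite_integrable_function by blast
  define \<nu> where "\<nu> = density M h"
  have sets: "sets \<nu> = sets M" by (simp add: \<nu>_def)
  interpret \<nu>: finite_measure \<nu>
    using h(1,2) by (intro finite_measureI) (simp add: \<nu>_def emeasure_density cong: nn_integral_cong)
  have null: "A \<in> null_sets M" if "A \<in> null_sets \<nu>" for A
  proof -
    have A: "A \<in> sets M" "AE x in M. x \<in> A \<longrightarrow> h x = 0"
      using that null_sets_density_iff[OF h(1)] by (auto simp: \<nu>_def)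
    have "AE x in M. h x \<noteq> 0"
      using h(3) by (intro AE_I2) (metis less_irrefl)
    with A(2) have "AE x in M. x \<notin> A"
      by eventually_elim blast
    then show ?thesis
      using AE_iff_null_sets[OF A(1)] by blast
  qed
  define \<F> where "\<F> = {F :: nat \<Rightarrow> 'a set. range F \<subseteq> \<G>}"
  obtain A0 where A0: "A0 \<in> \<G>"
    using assms(2) by blast
  then have "(\<lambda>_. A0) \<in> \<F>"
    by (auto simp: \<F>_def)
  then have ne: "\<F> \<noteq> {}" by blast
  obtain f :: "nat \<Rightarrow> ennreal" where f: "range f \<subseteq> (\<lambda>F. emeasure \<nu> (\<Union>k. F k)) ` \<F>"
      "(SUP F\<in>\<F>. emeasure \<nu> (\<Union>k. F k)) = (SUP i. f i)"
    using ennreal_SUP_countable_SUP[OF ne, of "\<lambda>F. emeasure \<nu> (\<Union>k. F k)"] by blast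
  have "\<forall>i. \<exists>F\<in>\<F>. f i = emeasure \<nu> (\<Union>k. F k)"
    using f(1) by blast
  then obtain F where F: "\<And>i. F i \<in> \<F>" "\<And>i. f i = emeasure \<nu> (\<Union>k. F i k)"
    by metis
  define G where "G m = (case prod_decode m of (i, k) \<Rightarrow> F i k)" for m
  have F_mem: "F i k \<in> \<G>" for i k
    using F(1)[of i] by (auto simp: \<F>_def)
  have G: "range G \<subseteq> \<G>"
    using F_mem by (auto simp: G_def split: prod.splits)
  have sub: "(\<Union>k. F i k) \<subseteq> (\<Union>m. G m)" for i
  proof
    fix x assume "x \<in> (\<Union>k. F i k)"
    then obtain k where "x \<in> F i k" by blast
    then have "x \<in> G (prod_encode (i, k))" by (simp add: G_def)
    then show "x \<in> (\<Union>m. G m)" by blast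
  qed
  have Gm: "(\<Union>m. G m) \<in> sets \<nu>"
    unfolding sets using G assms(1) by blast
  have max: "emeasure \<nu> (\<Union>k. H k) \<le> emeasure \<nu> (\<Union>m. G m)" if "H \<in> \<F>" for H
  proof -
    have "emeasure \<nu> (\<Union>k. H k) \<le> (SUP i. f i)"
      unfolding f(2)[symmetric] using that by (rule SUP_upper)
    also have "\<dots> \<le> emeasure \<nu> (\<Union>m. G m)"
      unfolding F(2) by (intro SUP_least emeasure_mono sub Gm)
    finally show ?thesis .
  qed
  have "A - (\<Union>k. G k) \<in> null_sets M" if A: "A \<in> \<G>" for A
  proof (rule null)
    have As: "A \<in> sets \<nu>" using A assms(1) sets by blast
    define H where "H k = (case k of 0 \<Rightarrow> A | Suc k \<Rightarrow> G k)" for k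
    have "H \<in> \<F>"
      using A subsetD[OF G rangeI] by (auto simp: \<F>_def H_def split: nat.splits)
    moreover have "(\<Union>k. H k) = (\<Union>k. G k) \<union> (A - (\<Union>k. G k))"
    proof -
      have "(\<Union>k. H k) = H 0 \<union> (\<Union>k. H (Suc k))"
        by (metis UNIV_nat_eq UN_insert image_image)
      then show ?thesis by (auto simp: H_def)
    qed
    ultimately have "emeasure \<nu> (\<Union>k. G k) + emeasure \<nu> (A - (\<Union>k. G k)) \<le> emeasure \<nu> (\<Union>k. G k) + 0"
      using max[of H] Gm As by (subst plus_emeasure) auto
    then have "emeasure \<nu> (A - (\<Union>k. G k)) \<le> 0"
      by (subst (asm) ennreal_add_left_cancel_le) (use \<nu>.emeasure_finite in \<open>auto simp: top_unique\<close>)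
    then show "A - (\<Union>k. G k) \<in> null_sets \<nu>"
      using Gm As by (intro null_setsI) auto
  qed
  then show thesis
    using that G by blast
qed

lemma doubling_sigma_finite:
  fixes M :: "'a::metric_space measure"
  assumes "doubling_metric_measure_space M"
  shows "sigma_finite_measure M"
proof
  have sets: "sets M = sets borel"
    using assms by (simp add: doubling_metric_measure_space_def)
  obtain C where C: "\<And>x r. r > 0 \<Longrightarrow> emeasure M (ball x (2 * r)) \<le> ennreal C * emeasure M (ball x r)
      \<and> ennreal C * emeasure M (ball x r) < \<infinity>"
    using assms unfolding doubling_metric_measure_space_def by blast
  have fin: "emeasure M (ball x r) < \<infinity>" if r: "r > 0" for x r
    using C[of "r / 2" x] r le_less_trans by auto
  define B where "B n = ball (undefined :: 'a) (real (Suc n))" for n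
  have "y \<in> (\<Union>n. B n)" for y
  proof -
    obtain n where "dist undefined y < real n"
      using reals_Archimedean2 by blast
    then have "y \<in> B n"
      by (simp add: B_def)
    then show ?thesis by blast
  qed
  then have "\<Union> (range B) = space M"
    using sets_eq_imp_space_eq[OF sets] by auto
  moreover have "range B \<subseteq> sets M"
    by (auto simp: B_def sets)
  moreover have "\<forall>b\<in>range B. emeasure M b \<noteq> \<infinity>"
    using fin[of "real (Suc n)" undefined for n] by (auto simp: B_def less_top)
  ultimately show "\<exists>A. countable A \<and> A \<subseteq> sets M \<and> \<Union> A = space M \<and> (\<forall>a\<in>A. emeasure M a \<noteq> \<infinity>)"
    by (intro exI[of _ "range B"]) auto
qed

section \<open>Construction of the charts\<close>

text \<open>Clamping makes a Lipschitz function bounded without changing it near points where it is small.\<close>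

definition clamp_at :: "nat \<Rightarrow> ('a \<Rightarrow> real) \<Rightarrow> 'a \<Rightarrow> real" where
  "clamp_at t f y = max (- real t) (min (real t) (f y))"

lemma lipschitz_clamp_at:
  assumes "L-lipschitz_on UNIV f"
  shows "L-lipschitz_on UNIV (clamp_at t f)"
proof (rule lipschitz_onI)
  fix x y
  have "dist (clamp_at t f x) (clamp_at t f y) \<le> dist (f x) (f y)"
    by (simp add: clamp_at_def dist_real_def)
  then show "dist (clamp_at t f x) (clamp_at t f y) \<le> L * dist x y"
    using lipschitz_onD[OF assms, of x y] by simp
qed (use assms in \<open>rule lipschitz_on_nonneg\<close>)

lemma Lip_inf_clamp_at:
  assumes "L-lipschitz_on UNIV f"
  shows "clamp_at t f \<in> Lip_inf"
proof -
  have "\<bar>clamp_at t f y\<bar> \<le> real t" for y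
    by (simp add: clamp_at_def)
  then show ?thesis
    using lipschitz_clamp_at[OF assms] by (auto simp: Lip_inf_def is_lipschitz_def bounded_iff)
qed

lemma pointwise_Lip_clamp_at:
  assumes f: "L-lipschitz_on UNIV f" and g: "is_lipschitz g" and t: "\<bar>f x\<bar> < real t"
  shows "pointwise_Lip (\<lambda>y. clamp_at t f y - g y) x = pointwise_Lip (\<lambda>y. f y - g y) x"
proof -
  have "isCont f x"
    using lipschitz_on_continuous_on[OF f] by (simp add: continuous_on_eq_continuous_at)
  then obtain r where r: "r > 0" "\<And>y. dist y x < r \<Longrightarrow> dist (f y) (f x) < real t - \<bar>f x\<bar>"
    using t unfolding continuous_at_eps_delta by (metis diff_gt_0_iff_gt)
  have "clamp_at t f y = f y" if "dist x y < r" for y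
    using r(2)[of y] that by (auto simp: clamp_at_def dist_commute dist_real_def)
  then show ?thesis
    using r(1) g f lipschitz_clamp_at[OF f, of t]
    by (intro pointwise_Lip_cong_near[of _ _ r] is_lipschitz_diff) (auto simp: is_lipschitz_def)
qed

lemma independent_at_mono:
  assumes "independent_at n \<xi> \<epsilon> x" "\<epsilon>' \<le> \<epsilon>"
  shows "independent_at n \<xi> \<epsilon>' x"
  unfolding independent_at_def
proof
  fix c :: "nat \<Rightarrow> real"
  have "\<epsilon>' * (\<Sum>j=1..n. \<bar>c j\<bar>) \<le> \<epsilon> * (\<Sum>j=1..n. \<bar>c j\<bar>)"
    using assms(2) by (intro mult_right_mono sum_nonneg) auto
  also have "\<dots> \<le> pointwise_Lip (\<lambda>y. \<Sum>j=1..n. c j * \<xi> j y) x"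
    using assms(1) by (simp add: independent_at_def)
  finally show "\<epsilon>' * (\<Sum>j=1..n. \<bar>c j\<bar>) \<le> pointwise_Lip (\<lambda>y. \<Sum>j=1..n. c j * \<xi> j y) x" .
qed

definition independent_sets :: "'a::metric_space measure \<Rightarrow> nat \<Rightarrow> 'a set set" where
  "independent_sets M n = {A \<in> sets M. \<exists>\<xi> \<epsilon>. (\<forall>j\<in>{1..n}. \<xi> j \<in> Lip_inf) \<and> \<epsilon> > 0 \<and>
     (\<forall>x\<in>A. independent_at n \<xi> \<epsilon> x)}"

text \<open>
  On a set where no tuple of length \<open>n + 1\<close> is independent, except on null sets, an independent
  tuple of length \<open>n\<close> is a system of coordinates. Existence: by \<open>independent_at_extend\<close>, \<open>f\<close> cannot
  have positive distance from the span of the coordinates on a non-null set; an unbounded \<open>f\<close> is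
  clamped first. Uniqueness and boundedness of the coefficients come from independence.
\<close>

lemma partial_derivatives_on_maximal_independent_set:
  fixes M :: "'a::metric_space measure"
  assumes sets: "sets M = sets borel" and X: "X \<in> sets M"
    and \<xi>: "\<And>j. j \<in> {1..n} \<Longrightarrow> \<xi> j \<in> Lip_inf" and \<epsilon>: "\<epsilon> > 0"
    and ind: "\<And>x. x \<in> X \<Longrightarrow> independent_at n \<xi> \<epsilon> x"
    and maximal: "\<And>A. A \<in> independent_sets M (Suc n) \<Longrightarrow> A \<subseteq> X \<Longrightarrow> A \<in> null_sets M"
    and f: "is_lipschitz f"
  shows "\<exists>g. partial_derivatives M X n \<xi> f g \<and>
    (\<forall>h. partial_derivatives M X n \<xi> f h \<longrightarrow> (\<forall>j\<in>{1..n}. AE x in restrict_space M X. h j x = g j x))"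
proof -
  obtain L where L: "L-lipschitz_on UNIV f"
    using f by (auto simp: is_lipschitz_def)
  have l\<xi>: "is_lipschitz (\<xi> j)" if "j \<in> {1..n}" for j
    using \<xi>[OF that] by (rule Lip_inf_is_lipschitz)
  have ls: "is_lipschitz (\<lambda>y. \<Sum>j=1..n. a j * \<xi> j y)" for a
    using l\<xi> by (intro is_lipschitz_sum) auto
  have AE_X: "(AE x in restrict_space M X. P x) \<longleftrightarrow> (AE x in M. x \<in> X \<longrightarrow> P x)" for P
    using X by (intro AE_restrict_space_iff) auto
  have "AE x in M. x \<in> X \<longrightarrow>
    \<not> independent_at (Suc n) (\<xi>(Suc n := clamp_at t f)) (1 / real (Suc i)) x" for t i
  proof -
    let ?\<xi> = "\<xi>(Suc n := clamp_at t f)"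
    let ?B = "X \<inter> {x. independent_at (Suc n) ?\<xi> (1 / real (Suc i)) x}"
    have *: "?\<xi> j \<in> Lip_inf" if "j \<in> {1..Suc n}" for j
      using \<xi>[of j] Lip_inf_clamp_at[OF L] that by (cases "j = Suc n") auto
    have B: "?B \<in> sets M"
    proof (rule sets.Int[OF X])
      show "{x. independent_at (Suc n) ?\<xi> (1 / real (Suc i)) x} \<in> sets M"
        unfolding sets by (intro sets_independent_at Lip_inf_is_lipschitz *)
    qed
    have "?B \<in> independent_sets M (Suc n)"
      unfolding independent_sets_def
      by (intro CollectI conjI B exI[of _ ?\<xi>] exI[of _ "1 / real (Suc i)"] ballI *) auto
    then have "?B \<in> null_sets M"
      by (rule maximal) blast
    then have "AE x in M. x \<notin> ?B"
      by (rule AE_not_in)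
    then show ?thesis by auto
  qed
  then have dependent: "AE x in M. x \<in> X \<longrightarrow> (\<forall>t i.
    \<not> independent_at (Suc n) (\<xi>(Suc n := clamp_at t f)) (1 / real (Suc i)) x)"
    by (simp only: AE_all_countable all_simps[symmetric]) blast
  have near: "\<exists>q. pointwise_Lip (\<lambda>y. f y - (\<Sum>j=1..n. q j * \<xi> j y)) x < \<delta>"
    if x: "x \<in> X" and dep: "\<forall>t i. \<not> independent_at (Suc n) (\<xi>(Suc n := clamp_at t f)) (1 / real (Suc i)) x"
      and \<delta>: "\<delta> > 0" for x \<delta>
  proof (rule ccontr)
    assume "\<not> ?thesis"
    then have far: "\<delta> \<le> pointwise_Lip (\<lambda>y. f y - (\<Sum>j=1..n. q j * \<xi> j y)) x" for q
      by (simp add: not_less)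
    obtain t where t: "\<bar>f x\<bar> < real t"
      using reals_Archimedean2 by blast
    have "independent_at (Suc n) (\<xi>(Suc n := clamp_at t f)) (\<delta> * \<epsilon> / (\<delta> + L + \<epsilon>)) x"
    proof (rule independent_at_extend[OF lipschitz_clamp_at[OF L] l\<xi> ind[OF x] \<epsilon> \<delta>])
      show "\<delta> \<le> pointwise_Lip (\<lambda>y. clamp_at t f y - (\<Sum>j=1..n. q j * \<xi> j y)) x" for q
        unfolding pointwise_Lip_clamp_at[OF L ls t] by (rule far)
    qed
    moreover have "0 < \<delta> * \<epsilon> / (\<delta> + L + \<epsilon>)"
      using \<delta> \<epsilon> lipschitz_on_nonneg[OF L] by (intro divide_pos_pos mult_pos_pos) auto
    then obtain i where "1 / real (Suc i) < \<delta> * \<epsilon> / (\<delta> + L + \<epsilon>)"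
      by (rule nat_approx_posE)
    ultimately have "independent_at (Suc n) (\<xi>(Suc n := clamp_at t f)) (1 / real (Suc i)) x"
      by (auto intro: independent_at_mono)
    then show False
      using dep by blast
  qed
  define g where "g = coefficient n \<xi> \<epsilon> (L / \<epsilon>) f"
  have g0: "AE x in M. x \<in> X \<longrightarrow> pointwise_Lip (\<lambda>y. f y - (\<Sum>j=1..n. g j x * \<xi> j y)) x = 0"
    using dependent
  proof eventually_elim
    case (elim x)
    show ?case
    proof
      assume x: "x \<in> X"
      show "pointwise_Lip (\<lambda>y. f y - (\<Sum>j=1..n. g j x * \<xi> j y)) x = 0"
        unfolding g_def
        by (rule pointwise_Lip_coefficient_eq_0[OF L l\<xi> ind[OF x] \<epsilon> near[OF x mp[OF elim x]]])
    qed
  qed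
  have "g j \<in> L_inf (restrict_space M X)" if "j \<in> {1..n}" for j
  proof -
    have "g j \<in> borel_measurable M"
      unfolding g_def measurable_cong_sets[OF sets refl] by (intro borel_measurable_coefficient f l\<xi>)
    then show ?thesis
      using abs_coefficient_le[OF L \<epsilon> that]
      by (auto simp: L_inf_def g_def intro!: measurable_restrict_space1 exI[of _ "L / \<epsilon>"])
  qed
  then have "partial_derivatives M X n \<xi> f g"
    using g0 by (simp add: partial_derivatives_def AE_X)
  moreover have "AE x in restrict_space M X. h j x = g j x"
    if h: "partial_derivatives M X n \<xi> f h" and j: "j \<in> {1..n}" for h j
  proof -
    have "AE x in M. x \<in> X \<longrightarrow> pointwise_Lip (\<lambda>y. f y - (\<Sum>j=1..n. h j x * \<xi> j y)) x = 0"
      using h by (simp add: partial_derivatives_def AE_X)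
    with g0 have "AE x in M. x \<in> X \<longrightarrow> h j x = g j x"
    proof eventually_elim
      case (elim x)
      show ?case
      proof
        assume x: "x \<in> X"
        have "\<epsilon> * \<bar>h j x - g j x\<bar> \<le> \<epsilon> * (\<Sum>j=1..n. \<bar>h j x - g j x\<bar>)"
          using \<epsilon> j by (intro mult_left_mono member_le_sum) auto
        also have "\<dots> \<le> pointwise_Lip (\<lambda>y. \<Sum>j=1..n. (h j x - g j x) * \<xi> j y) x"
          using ind[OF x] unfolding independent_at_def by (rule spec)
        also have "(\<lambda>y. \<Sum>j=1..n. (h j x - g j x) * \<xi> j y) =
            (\<lambda>y. (\<Sum>j=1..n. h j x * \<xi> j y) - (\<Sum>j=1..n. g j x * \<xi> j y))"
          by (simp add: left_diff_distrib sum_subtractf)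
        also have "pointwise_Lip \<dots> x \<le> 0"
          using pointwise_Lip_diff_triangle[OF ls f ls, of "\<lambda>j. h j x" "\<lambda>j. g j x" x]
            pointwise_Lip_diff_commute[OF ls f, of "\<lambda>j. h j x" x] elim x by simp
        finally show "h j x = g j x"
          using \<epsilon> by (simp add: mult_le_0_iff)
      qed
    qed
    then show ?thesis
      by (simp add: AE_X)
  qed
  ultimately show ?thesis by blast
qed

theorem theorem5p9:
  fixes M :: "'a::metric_space measure"
    and N :: nat
    and D :: "nat \<Rightarrow> ('a \<Rightarrow> real) \<Rightarrow> ('a \<Rightarrow> real)"
    and lam :: "'a \<Rightarrow> real"
  assumes "doubling_metric_measure_space M"
    and "\<forall>j\<in>{1..N}. D j \<in> Der M"
    and "lam \<in> L_inf M"
    and "AE x in M. lam x > 0"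
    and "\<forall>f\<in>Lip_inf. \<exists>\<Omega>\<in>null_sets M. \<forall>x\<in>space M - \<Omega>.
           Max (insert 0 ((\<lambda>j. \<bar>D j f x\<bar>) ` {1..N})) \<ge> lam x * pointwise_Lip f x"
  shows "\<exists>I X n \<xi>. measurable_differentiable_structure M I X n \<xi> \<and>
           structure_dimension I n \<le> N"
proof -
  interpret sigma_finite_measure M
    using assms(1) by (rule doubling_sigma_finite)
  have sets: "sets M = sets borel"
    using assms(1) by (simp add: doubling_metric_measure_space_def)
  have space: "space M = UNIV"
    using sets_eq_imp_space_eq[OF sets] by simp
  have bound: "AE x in M. lam x * pointwise_Lip f x \<le> (\<Sum>i=1..N. \<bar>D i f x\<bar>)" if "f \<in> Lip_inf" for f
  proof -
    from bspec[OF assms(5) that] obtain \<Omega> where \<Omega>: "\<Omega> \<in> null_sets M" "\<forall>x\<in>space M - \<Omega>.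
        lam x * pointwise_Lip f x \<le> Max (insert 0 ((\<lambda>j. \<bar>D j f x\<bar>) ` {1..N}))"
      by (rule bexE)
    \<comment> \<open>The sum, unlike the maximum, passes to limits term by term.\<close>
    have max: "Max (insert 0 ((\<lambda>j. \<bar>D j f x\<bar>) ` {1..N})) \<le> (\<Sum>i=1..N. \<bar>D i f x\<bar>)" for x
    proof (rule Max.boundedI)
      have "\<bar>D j f x\<bar> \<le> (\<Sum>i=1..N. \<bar>D i f x\<bar>)" if "j \<in> {1..N}" for j
        by (rule member_le_sum[OF that, of "\<lambda>i. \<bar>D i f x\<bar>"]) auto
      then show "a \<le> (\<Sum>i=1..N. \<bar>D i f x\<bar>)" if "a \<in> insert 0 ((\<lambda>j. \<bar>D j f x\<bar>) ` {1..N})" for a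
        using that by (auto simp: sum_nonneg)
    qed auto
    have "lam x * pointwise_Lip f x \<le> (\<Sum>i=1..N. \<bar>D i f x\<bar>)" if "x \<notin> \<Omega>" for x
    proof (rule order_trans[OF bspec[OF \<Omega>(2)] max])
      show "x \<in> space M - \<Omega>"
        using that space by simp
    qed
    with AE_not_in[OF \<Omega>(1)] show ?thesis
      by (rule eventually_mono)
  qed
  have large: "A \<in> null_sets M" if "A \<in> independent_sets M n" "N < n" for A n
  proof -
    from that(1) obtain \<xi> \<epsilon> where A: "A \<in> sets M" "\<And>j. j \<in> {1..n} \<Longrightarrow> \<xi> j \<in> Lip_inf"
        "\<epsilon> > 0" "\<And>x. x \<in> A \<Longrightarrow> independent_at n \<xi> \<epsilon> x"
      unfolding independent_sets_def by blast
    show ?thesis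
    proof (rule null_sets_independent_if_more_than_derivations[OF _ assms(4) _ A(1) that(2) A(2-4)])
      show "D i \<in> Der M" if "i \<in> {1..N}" for i
        using assms(2) that by blast
    qed (rule bound)
  qed
  have "\<exists>G :: nat \<Rightarrow> 'a set. range G \<subseteq> independent_sets M n \<and>
      (\<forall>A\<in>independent_sets M n. A - (\<Union>k. G k) \<in> null_sets M)" for n
  proof -
    have ne: "{} \<in> independent_sets M n"
      unfolding independent_sets_def
      by (intro CollectI conjI exI[of _ "\<lambda>_ _. 0"] exI[of _ 1] ballI Lip_inf_zero) simp_all
    have sub: "independent_sets M n \<subseteq> sets M"
      by (auto simp: independent_sets_def)
    show ?thesis
    proof (rule countable_essential_cover[OF sub])
      show "independent_sets M n \<noteq> {}"
        using ne by blast
    next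
      fix G :: "nat \<Rightarrow> 'a set"
      assume "range G \<subseteq> independent_sets M n"
        and "\<And>A. A \<in> independent_sets M n \<Longrightarrow> A - (\<Union>k. G k) \<in> null_sets M"
      then show ?thesis by blast
    qed
  qed
  then have "\<exists>G :: nat \<Rightarrow> nat \<Rightarrow> 'a set. \<forall>n. range (G n) \<subseteq> independent_sets M n \<and>
      (\<forall>A\<in>independent_sets M n. A - (\<Union>k. G n k) \<in> null_sets M)"
    by (intro choice) blast
  then obtain G :: "nat \<Rightarrow> nat \<Rightarrow> 'a set" where
    "\<And>n. range (G n) \<subseteq> independent_sets M n \<and> (\<forall>A\<in>independent_sets M n. A - (\<Union>k. G n k) \<in> null_sets M)"
    by blast
  then have G: "\<And>n k. G n k \<in> independent_sets M n"
    and cover: "\<And>n A. A \<in> independent_sets M n \<Longrightarrow> A - (\<Union>k. G n k) \<in> null_sets M"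
    by blast+
  have G_sets: "G n k \<in> sets M" for n k
    using G by (auto simp: independent_sets_def)
  have "\<forall>p. \<exists>q. (\<forall>j\<in>{1..fst p}. fst q j \<in> Lip_inf) \<and> snd q > 0 \<and>
      (\<forall>x\<in>G (fst p) (snd p). independent_at (fst p) (fst q) (snd q) x)"
    using G by (auto simp: independent_sets_def)
  from choice[OF this] obtain Q where Q: "\<forall>p. (\<forall>j\<in>{1..fst p}. fst (Q p) j \<in> Lip_inf) \<and> snd (Q p) > 0 \<and>
      (\<forall>x\<in>G (fst p) (snd p). independent_at (fst p) (fst (Q p)) (snd (Q p)) x)"
    by (rule exE)
  define \<xi> where "\<xi> n k = fst (Q (n, k))" for n k
  define \<epsilon> where "\<epsilon> n k = snd (Q (n, k))" for n k
  have \<xi>: "\<xi> n k j \<in> Lip_inf" if "j \<in> {1..n}" for n k j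
    using Q[rule_format, of "(n, k)"] that by (auto simp: \<xi>_def)
  have \<epsilon>: "\<epsilon> n k > 0" for n k
    using Q[rule_format, of "(n, k)"] by (auto simp: \<epsilon>_def)
  have ind: "independent_at n (\<xi> n k) (\<epsilon> n k) x" if "x \<in> G n k" for n k x
    using Q[rule_format, of "(n, k)"] that by (auto simp: \<xi>_def \<epsilon>_def)
  \<comment> \<open>Removing all sets with more independent functions makes \<open>n\<close> maximal on what remains.\<close>
  define X where "X n k = G n k - (\<Union>k'<k. G n k') - (\<Union>m\<in>{n<..}. \<Union>k'. G m k')" for n k
  have X_sets: "X n k \<in> sets M" for n k
    unfolding X_def using G_sets by (intro sets.Diff sets.countable_UN') auto
  have disjoint: "X n k \<inter> X m l = {}" if "(n, k) \<noteq> (m, l)" for n k m l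
  proof -
    have "n < m \<or> m < n \<or> (n = m \<and> k < l) \<or> (n = m \<and> l < k)"
      using that by auto
    then show ?thesis
      by (auto simp: X_def)
  qed
  define I where "I = {\<alpha>. fst (prod_decode \<alpha>) \<le> N}"
  define dim where "dim \<alpha> = fst (prod_decode \<alpha>)" for \<alpha>
  define idx where "idx \<alpha> = snd (prod_decode \<alpha>)" for \<alpha>
  have "measurable_differentiable_structure M I (\<lambda>\<alpha>. X (dim \<alpha>) (idx \<alpha>)) dim (\<lambda>\<alpha>. \<xi> (dim \<alpha>) (idx \<alpha>))"
    unfolding measurable_differentiable_structure_def
  proof (intro conjI ballI allI impI)
    show "disjoint_family_on (\<lambda>\<alpha>. X (dim \<alpha>) (idx \<alpha>)) I"
    proof (unfold disjoint_family_on_def, intro ballI impI)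
      fix \<alpha> \<beta> :: nat assume "\<alpha> \<noteq> \<beta>"
      then have "prod_decode \<alpha> \<noteq> prod_decode \<beta>"
        by simp
      then have "(dim \<alpha>, idx \<alpha>) \<noteq> (dim \<beta>, idx \<beta>)"
        by (simp add: dim_def idx_def prod_eq_iff)
      then show "X (dim \<alpha>) (idx \<alpha>) \<inter> X (dim \<beta>) (idx \<beta>) = {}"
        by (rule disjoint)
    qed
    have "space M - (\<Union>k. G 0 k) \<in> null_sets M"
    proof (rule cover)
      have "independent_at 0 \<eta> 1 x" for \<eta> and x :: 'a
        using pointwise_Lip_nonneg[OF is_lipschitz_const, of 0 x] by (simp add: independent_at_def)
      then show "space M \<in> independent_sets M 0"
        unfolding independent_sets_def by (intro CollectI conjI exI[of _ "\<lambda>_ _. 0"] exI[of _ 1]) simp_all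
    qed
    moreover have "(\<Union>m\<in>{N<..}. \<Union>k. G m k) \<in> null_sets M"
    proof (intro null_sets_UN')
      show "G m k \<in> null_sets M" if "m \<in> {N<..}" for m k
        using large[OF G] that by simp
    qed auto
    ultimately have null: "(space M - (\<Union>k. G 0 k)) \<union> (\<Union>m\<in>{N<..}. \<Union>k. G m k) \<in> null_sets M"
      by (rule null_sets.Un)
    have "x \<in> (\<Union>\<alpha>\<in>I. X (dim \<alpha>) (idx \<alpha>))"
      if x: "x \<in> (\<Union>k. G 0 k)" "x \<notin> (\<Union>m\<in>{N<..}. \<Union>k. G m k)" for x
    proof -
      have le: "m \<le> N" if "x \<in> G m k" for m k
      proof (rule ccontr)
        assume "\<not> m \<le> N"
        then have "x \<in> (\<Union>m\<in>{N<..}. \<Union>k. G m k)"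
          using that by auto
        then show False
          using x(2) by simp
      qed
      define n where "n = (GREATEST n. \<exists>k. x \<in> G n k)"
      have ex: "\<exists>k. x \<in> G n k"
        unfolding n_def using x(1) le by (intro GreatestI_nat[of "\<lambda>n. \<exists>k. x \<in> G n k" 0 N]) blast+
      have n_max: "m \<le> n" if "x \<in> G m k" for m k
        unfolding n_def using that le by (intro Greatest_le_nat[of "\<lambda>n. \<exists>k. x \<in> G n k" m N]) blast+
      define k where "k = (LEAST k. x \<in> G n k)"
      have k: "x \<in> G n k"
        unfolding k_def using ex by (rule LeastI_ex)
      have k_min: "x \<notin> G n k'" if "k' < k" for k'
        using that unfolding k_def by (rule not_less_Least)
      have "x \<in> X n k"
        using k k_min leD[OF n_max] by (auto simp: X_def)
      moreover have "n \<le> N"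
        using le k by blast
      ultimately show ?thesis
        by (intro UN_I[of "prod_encode (n, k)"]) (auto simp: I_def dim_def idx_def)
    qed
    then have "space M - (\<Union>\<alpha>\<in>I. X (dim \<alpha>) (idx \<alpha>)) \<subseteq>
        (space M - (\<Union>k. G 0 k)) \<union> (\<Union>m\<in>{N<..}. \<Union>k. G m k)"
      by blast
    moreover have "space M - (\<Union>\<alpha>\<in>I. X (dim \<alpha>) (idx \<alpha>)) \<in> sets M"
      using X_sets by (intro sets.Diff sets.top sets.countable_UN') auto
    ultimately show "space M - (\<Union>\<alpha>\<in>I. X (dim \<alpha>) (idx \<alpha>)) \<in> null_sets M"
      using null_sets_subset[OF null] by blast
    show "bdd_above (dim ` I)"
      by (auto simp: I_def dim_def intro!: bdd_aboveI2[of _ _ N])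
    show "is_lipschitz (\<xi> (dim \<alpha>) (idx \<alpha>) j)" if "j \<in> {1..dim \<alpha>}" for \<alpha> j
      using \<xi>[OF that] by (rule Lip_inf_is_lipschitz)
    show "\<exists>g. partial_derivatives M (X (dim \<alpha>) (idx \<alpha>)) (dim \<alpha>) (\<xi> (dim \<alpha>) (idx \<alpha>)) f g \<and>
        (\<forall>h. partial_derivatives M (X (dim \<alpha>) (idx \<alpha>)) (dim \<alpha>) (\<xi> (dim \<alpha>) (idx \<alpha>)) f h \<longrightarrow>
          (\<forall>j\<in>{1..dim \<alpha>}. AE x in restrict_space M (X (dim \<alpha>) (idx \<alpha>)). h j x = g j x))"
      if f: "is_lipschitz f" for \<alpha> f
    proof (rule partial_derivatives_on_maximal_independent_set[OF sets X_sets \<xi> \<epsilon> _ _ f])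
      show "independent_at (dim \<alpha>) (\<xi> (dim \<alpha>) (idx \<alpha>)) (\<epsilon> (dim \<alpha>) (idx \<alpha>)) x"
        if "x \<in> X (dim \<alpha>) (idx \<alpha>)" for x
        using that by (intro ind) (simp add: X_def)
      show "A \<in> null_sets M" if A: "A \<in> independent_sets M (Suc (dim \<alpha>))" "A \<subseteq> X (dim \<alpha>) (idx \<alpha>)" for A
      proof -
        have "A - (\<Union>k. G (Suc (dim \<alpha>)) k) = A"
          using A(2) by (auto simp: X_def)
        then show ?thesis
          using cover[OF A(1)] by simp
      qed
    qed
  qed (rule X_sets)
  moreover have "structure_dimension I dim \<le> N"
    unfolding structure_dimension_def
  proof (rule cSUP_least)
    have "prod_encode (0, 0) \<in> I"
      by (simp add: I_def)
    then show "I \<noteq> {}" by blast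
  qed (simp add: I_def dim_def)
  ultimately show ?thesis by blast
qed

end
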